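(* Let $G$ be a graph that contains no cycle (induced or not) whose length is divisible by three. Then $\mathrm{Ind}(G)$ is contractible or homotopy equivalent to a sphere.
   Context: Graphs are finite and simple (no loops or multiple edges). The independence complex $\mathrm{Ind}(G)$ of a graph $G$ is the simplicial complex on the vertex set $V(G)$ whose faces are the independent sets of $G$ (sets of pairwise non-adjacent vertices), including the empty set. A cycle of $G$ is a (not necessarily induced) subgraph that is a cycle graph; its length is its number of edges. Convention: the complex $\{\emptyset\}$, which is the independence complex of the graph without vertices, is regarded as the sphere $S^{-1}$ of dimension $-1$. *)

theory Defs
  imports "HOL-Analysis.Analysis" "Graph_Theory.Arc_Walk"
begin

text \<open>
  A finite simple graph is a symmetric loop-free digraph without parallel arcs
  (locale \<^locale>\<open>graph\<close>): each edge is represented by its two opposite arcs.  In this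
  representation \<^const>\<open>pre_digraph.cycle\<close> also accepts the closed walk that runs along one edge
  and back.  It has length two and is not a cycle of the undirected graph.  Every longer
  one is, since it visits pairwise distinct vertices.
\<close>

definition ucycle :: "('a, 'b) pre_digraph \<Rightarrow> 'b awalk \<Rightarrow> bool" where
  "ucycle G p \<longleftrightarrow> pre_digraph.cycle G p \<and> 3 \<le> length p"

definition independent_set :: "('a, 'b) pre_digraph \<Rightarrow> 'a set \<Rightarrow> bool" where
  "independent_set G S \<longleftrightarrow> S \<subseteq> verts G \<and> (\<forall>u\<in>S. \<forall>v\<in>S. \<not> u \<rightarrow>\<^bsub>G\<^esub> v)"

definition independence_complex :: "('a, 'b) pre_digraph \<Rightarrow> 'a set set" where
  "independence_complex G = {S. independent_set G S}"

text \<open>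
  Geometric realization of an abstract simplicial complex, given as its set of faces
  (the empty face included), in barycentric coordinates.  The product topology is the
  right one for finite complexes only.  The realization of \<open>{{}}\<close> is the empty space.
\<close>

definition geometric_realization :: "'a set set \<Rightarrow> ('a \<Rightarrow> real) topology" where
  "geometric_realization K = subtopology (powertop_real UNIV)
     {x. (\<forall>v. 0 \<le> x v) \<and> {v. x v \<noteq> 0} \<in> K \<and> (\<Sum>v | x v \<noteq> 0. x v) = 1}"

text \<open>The sphere of dimension \<open>d \<ge> -1\<close>; the one of dimension \<open>-1\<close> is the empty space.
  Note that \<^const>\<open>contractible_space\<close> holds of the empty space, so contractibility in the
  usual sense also requires a nonempty \<^const>\<open>topspace\<close>.\<close>

definition sphere_space :: "int \<Rightarrow> (nat \<Rightarrow> real) topology" where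
  "sphere_space d = (if d < 0 then trivial_topology else nsphere (nat d))"

end

theory Submission
  imports Defs "HOL-Homology.Homology"
begin

text \<open>
  A vertex \<open>v\<close> splits the independence complex of a graph \<open>G\<close> into the deletion
  \<open>Ind(G - v)\<close> and a cone over the link \<open>Ind(G - N[v])\<close>.  If the link is contractible, then
  \<open>v\<close> can be deleted without changing the homotopy type; if the deletion is contractible, then
  \<open>Ind(G)\<close> is the suspension of the link.  The hypothesis on cycles passes to induced
  subgraphs, so a minimal counterexample is a graph whose proper induced subgraphs all satisfy
  the theorem, but for which the link and the deletion of every vertex are both spheres.

  This situation is rigid.  The number of independent sets is even for the graphs with
  contractible complex and odd for those with a sphere, by induction: it is the sum of the
  numbers for link and deletion.  In a proper induced subgraph two spheres therefore leave only a
  contractible complex, and two suspensions of a one-leaf extension show that the spheres then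
  have the same dimension.  Given disjoint vertex sets \<open>X\<close> and \<open>Y\<close>, not both empty, let
  \<open>lev X Y\<close> be \<open>m + |Y|\<close> if \<open>Y\<close> is independent and the graph \<open>G - X - N[Y]\<close> has the complex
  \<open>S\<^sup>m\<^sup>-\<^sup>1\<close>, and undefined otherwise.  Forcing one more vertex \<open>w\<close> out of or into the
  independent set then obeys a single rule: if only one of \<open>lev (insert w X) Y\<close> and
  \<open>lev X (insert w Y)\<close> is defined, it is \<open>lev X Y\<close>, and if both are, then the second is the
  first plus one and \<open>lev X Y\<close> is undefined (\<open>splits\<close>, \<open>level_splits\<close>).

  The rest is combinatorics of this partial function (locale \<open>critical\<close>).  Call two vertices
  twins if they can be forced out together with a defined level.  In the cycle \<open>C\<^sub>3\<^sub>k\<close>,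
  whose complex is not a sphere, twins are the vertices at distance divisible by three, and much
  of this picture survives in general.  Being twins is an equivalence relation (\<open>twin_trans\<close>),
  adjacent vertices are not twins (\<open>adj_not_twin\<close>), every edge \<open>vu\<close> continues to a neighbour
  of \<open>u\<close> that is no twin of \<open>v\<close> (\<open>third_class\<close>), and after three such edges one is back in the
  first class (\<open>path_returns\<close>).  So the classes along a walk of such edges repeat with
  period three, and the first cycle that such a walk closes has length divisible by three
  (\<open>cycle_mod_3\<close>), contrary to the hypothesis.

  Suspension is kept inside graph theory: the join with the two isolated points of an edge is the
  independence complex of the disjoint union with that edge.  Accordingly every statement about a
  graph is made for its disjoint unions with \<open>k\<close> edges, for all \<open>k\<close>, and \<open>k\<close> edges alone
  give the boundary of a cross polytope (\<open>cross_polytope_sphere\<close>).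
\<close>

section \<open>Geometric realizations\<close>

abbreviation supp :: "('a \<Rightarrow> real) \<Rightarrow> 'a set" where "supp x \<equiv> {v. x v \<noteq> 0}"

definition finite_complex :: "'a set set \<Rightarrow> bool" where
  "finite_complex K \<longleftrightarrow> finite (\<Union>K) \<and> (\<forall>S\<in>K. \<forall>T\<subseteq>S. T \<in> K)"

definition points :: "'a set set \<Rightarrow> ('a \<Rightarrow> real) set" where
  "points K = {x. (\<forall>v. 0 \<le> x v) \<and> supp x \<in> K \<and> (\<Sum>v | x v \<noteq> 0. x v) = 1}"

lemma geometric_realization_eq: "geometric_realization K = top_of_set (points K)"
  by (simp add: geometric_realization_def points_def flip: euclidean_product_topology)

lemma sum_supp:
  assumes "finite V" "supp x \<subseteq> V" shows "(\<Sum>v | x v \<noteq> (0::real). x v) = sum x V"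
  using assms by (intro sum.mono_neutral_left) auto

lemma points_iff:
  assumes "finite V" "\<Union>K \<subseteq> V"
  shows "x \<in> points K \<longleftrightarrow> (\<forall>v. 0 \<le> x v) \<and> supp x \<in> K \<and> sum x V = 1"
proof -
  have "supp x \<subseteq> V" if "supp x \<in> K" using that assms(2) by blast
  then show ?thesis using sum_supp[OF assms(1), of x] by (auto simp: points_def)
qed

lemma finite_complex_subset: "finite_complex K \<Longrightarrow> S \<in> K \<Longrightarrow> T \<subseteq> S \<Longrightarrow> T \<in> K"
  by (auto simp: finite_complex_def)

lemma points_convex:
  assumes K: "finite_complex K" and xy: "x \<in> points K" "y \<in> points K" "supp x \<union> supp y \<in> K"
    and t: "0 \<le> t" "t \<le> 1"
  shows "(\<lambda>v. (1 - t) * x v + t * y v) \<in> points K"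
proof -
  have fin: "finite (\<Union>K)" using K by (simp add: finite_complex_def)
  have "supp (\<lambda>v. (1 - t) * x v + t * y v) \<in> K"
    by (rule finite_complex_subset[OF K xy(3)]) auto
  moreover have "sum (\<lambda>v. (1 - t) * x v + t * y v) (\<Union>K) = 1"
    using xy by (simp add: points_iff[OF fin] sum.distrib flip: sum_distrib_left)
  ultimately show ?thesis
    using xy t by (auto simp: points_iff[OF fin])
qed

lemma homotopic_on_iff:
  "homotopic_with_canon (\<lambda>_. True) S T f g \<longleftrightarrow>
    (\<exists>h. continuous_on ({0..1::real} \<times> S) h \<and> h ` ({0..1} \<times> S) \<subseteq> T \<and>
      (\<forall>x\<in>S. h (0, x) = f x) \<and> (\<forall>x\<in>S. h (1, x) = g x))"
  by (subst homotopic_with) (auto simp: prod_topology_subtopology_eu continuous_map_subtopology_eu)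

text \<open>
  Maps into a complex that send each point into a common face are homotopic: the segment between
  the two images never leaves that face.
\<close>

lemma straight_line_homotopic:
  fixes f g :: "'b::topological_space \<Rightarrow> 'a \<Rightarrow> real"
  assumes K: "finite_complex K" and "continuous_on S f" "continuous_on S g"
    and "\<And>x. x \<in> S \<Longrightarrow> f x \<in> points K" "\<And>x. x \<in> S \<Longrightarrow> g x \<in> points K"
    and "\<And>x. x \<in> S \<Longrightarrow> supp (f x) \<union> supp (g x) \<in> K"
  shows "homotopic_with_canon (\<lambda>_. True) S (points K) f g"

  unfolding homotopic_on_iff
proof (intro exI conjI ballI)
  let ?h = "\<lambda>(t, x) v. (1 - t) * f x v + t * g x v"
  have "continuous_on ({0..1} \<times> S) (\<lambda>p. f (snd p))" "continuous_on ({0..1} \<times> S) (\<lambda>p. g (snd p))"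
    by (rule continuous_on_compose2[OF assms(2)] continuous_on_compose2[OF assms(3)];
        force intro: continuous_on_snd)+
  note c = this[THEN continuous_on_product_then_coordinatewise]
  show "continuous_on ({0..1} \<times> S) ?h"
    unfolding case_prod_beta
    by (rule continuous_on_coordinatewise_then_product) (intro continuous_intros c)
  show "?h ` ({0..1} \<times> S) \<subseteq> points K"
    using points_convex[OF K] assms(4-6) by auto
qed auto

lemma continuous_on_closed_pieces:
  assumes "closed P" "closed Q" "S \<subseteq> P \<union> Q" "continuous_on (S \<inter> P) f" "continuous_on (S \<inter> Q) f"
  shows "continuous_on S f"
proof -
  have S: "S = (S \<inter> P) \<union> (S \<inter> Q)" using assms(3) by auto
  have "continuous_on ((S \<inter> P) \<union> (S \<inter> Q)) (\<lambda>x. if True then f x else f x)"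
    using assms S by (intro continuous_on_cases_local) (auto simp: closedin_closed_Int simp flip: S)
  then show ?thesis using S by simp
qed

lemma closed_coordinates:
  fixes v :: 'a
  shows "closed {x :: 'a \<Rightarrow> real. x v = c}" "closed {x :: 'a \<Rightarrow> real. x v \<le> c}"
    "closed {x :: 'a \<Rightarrow> real. c \<le> x v}" "closed {x :: 'a \<Rightarrow> real. \<forall>u. u \<notin> S \<longrightarrow> x u = 0}"
  by (intro closed_Collect_eq closed_Collect_le closed_Collect_all closed_Collect_imp
        continuous_on_const continuous_on_product_coordinates open_Collect_const)+

section \<open>Deleting a vertex with contractible link\<close>

definition link :: "'a set set \<Rightarrow> 'a \<Rightarrow> 'a set set" where
  "link K v = {S. v \<notin> S \<and> insert v S \<in> K}"

definition deletion :: "'a set set \<Rightarrow> 'a \<Rightarrow> 'a set set" where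
  "deletion K v = {S \<in> K. v \<notin> S}"

lemma points_deletion: "points (deletion K v) = {x \<in> points K. x v = 0}"
  by (auto simp: points_def deletion_def)

text \<open>
  Write a point of the star of \<open>v\<close> as \<open>s v + (1 - s) l\<close> with \<open>l\<close> in the link, and let \<open>h\<close>
  contract the link to \<open>c\<close>.  The map \<open>r\<close> that runs \<open>h\<close> up to time \<open>2 s\<close>, and is \<open>c\<close> once
  \<open>s \<ge> 1/2\<close>, retracts the complex onto the deletion.  It is homotopic to the identity through
  \<open>m\<close>, which keeps the summand \<open>2 s v\<close> while \<open>h\<close> is being switched on; both ends of this
  homotopy are joined to the identity and to \<open>r\<close> by straight lines.  Doubling \<open>s\<close> makes all
  formulas constant near \<open>v\<close>, where \<open>l\<close> has no limit.
\<close>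

theorem delete_vertex_contractible_link:
  assumes K: "finite_complex K"
    and ne: "points (link K v) \<noteq> {}" and contr: "contractible (points (link K v))"
  shows "geometric_realization K homotopy_equivalent_space geometric_realization (deletion K v)"
proof -
  let ?X = "points K" and ?L = "points (link K v)"
  define e where "e = (\<lambda>u. if u = v then 1 else 0 :: real)"
  obtain c h where h: "continuous_on ({0..1::real} \<times> ?L) h" "h ` ({0..1} \<times> ?L) \<subseteq> ?L"
    and h0: "\<And>x. x \<in> ?L \<Longrightarrow> h (0, x) = x" and h1: "\<And>x. x \<in> ?L \<Longrightarrow> h (1, x) = c"
    using contr unfolding contractible_def homotopic_on_iff by auto
  have cL: "c \<in> ?L" using ne h(2) h1 by (auto simp: image_subset_iff) (metis atLeastAtMost_iff order_refl zero_le_one)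
  have fin: "finite (\<Union>K)" using K by (simp add: finite_complex_def)
  have L: "y \<in> ?X" "y v = 0" "insert v (supp y) \<in> K" "v \<in> supp e" "supp e = {v}" if "y \<in> ?L" for y
    using that finite_complex_subset[OF K, of "insert v (supp y)" "supp y"]
    by (auto simp: points_def link_def e_def)
  have eX: "e \<in> ?X"
    using L[OF cL] finite_complex_subset[OF K, of "insert v (supp c)" "{v}"] by (auto simp: points_def e_def)
  define l where "l x = (\<lambda>u. if u = v then 0 else x u / (1 - x v))" for x :: "'a \<Rightarrow> real"
  define B where "B = {x \<in> ?X. insert v (supp x) \<in> K \<and> x v \<le> 1/2}"
  have lL: "l x \<in> ?L" if "x \<in> B" for x
  proof -
    have x: "\<forall>u. 0 \<le> x u" "supp x \<in> K" "sum x (supp x) = 1" "insert v (supp x) \<in> K" "x v \<le> 1/2"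
      using that by (auto simp: B_def points_def)
    have "finite (supp x)" using x(3) by (metis sum.infinite zero_neq_one)
    have s: "supp (l x) = supp x - {v}" using x by (auto simp: l_def)
    have "sum (l x) (supp x - {v}) = sum x (supp x - {v}) / (1 - x v)"
      by (simp add: l_def sum_divide_distrib)
    also have "sum x (supp x - {v}) = 1 - x v"
      using x(3) sum.remove[OF \<open>finite (supp x)\<close>, of v x] by (cases "x v = 0") auto
    finally have "sum (l x) (supp x - {v}) = 1" using x by simp
    moreover have "insert v (supp x - {v}) \<in> K" using x(4) by (simp add: insert_absorb)
    moreover have "0 \<le> l x u" for u using x by (auto simp: l_def)
    moreover have "l x v = 0" by (simp add: l_def)
    ultimately show ?thesis by (simp add: points_def link_def s)
  qed
  have l_id: "l x = x" if "x v = 0" for x using that by (auto simp: l_def)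
  have contu: "continuous_on S (\<lambda>x. x u)" for S :: "('a \<Rightarrow> real) set" and u
    by (rule continuous_on_subset[OF continuous_on_product_coordinates]) simp
  have contv: "continuous_on S (\<lambda>x. x v)" for S :: "('a \<Rightarrow> real) set"
    by (rule contu)
  have contl: "continuous_on B l"
    unfolding l_def
  proof (rule continuous_on_coordinatewise_then_product)
    fix u
    show "continuous_on B (\<lambda>x. if u = v then 0 else x u / (1 - x v))"
      by (cases "u = v") (auto simp: B_def intro!: continuous_intros contu)
  qed
  have cv2: "continuous_on ({0..1::real} \<times> B) (\<lambda>p. snd p v)"
    by (rule continuous_on_compose2[OF contv[of UNIV]]) (auto intro: continuous_on_snd)
  have cl2: "continuous_on ({0..1::real} \<times> B) (\<lambda>p. l (snd p))"
    by (rule continuous_on_compose2[OF contl]) (auto intro: continuous_on_snd)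
  have unit: "2 * t * x v \<in> {0..1}" if "x \<in> B" "0 \<le> t" "t \<le> 1" for t x
  proof -
    have "0 \<le> x v" "x v \<le> 1/2" using that by (auto simp: B_def points_def)
    then show ?thesis using that mult_mono[of "2 * t" 2 "x v" "1/2"] by auto
  qed
  have conthl: "continuous_on ({0..1} \<times> B) (\<lambda>p. h (2 * fst p * snd p v, l (snd p)))"
  proof (rule continuous_on_compose2[OF h(1)])
    show "continuous_on ({0..1} \<times> B) (\<lambda>p. (2 * fst p * snd p v, l (snd p)))"
      by (intro continuous_on_Pair continuous_on_mult continuous_on_const continuous_on_fst
          continuous_on_id cv2 cl2)
    show "(\<lambda>p. (2 * fst p * snd p v, l (snd p))) ` ({0..1} \<times> B) \<subseteq> {0..1} \<times> ?L"
      using lL unit by auto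
  qed
  define m where "m = (\<lambda>(t, x). if x v = 0 then x
    else if x v \<le> 1/2 then (\<lambda>u. (1 - 2 * x v) * h (2 * t * x v, l x) u + 2 * x v * e u) else e)"
  define r where "r x = (if x v = 0 then x else if x v \<le> 1/2 then h (2 * x v, l x) else c)" for x
  have hL: "h (2 * t * x v, l x) \<in> ?L" if "x \<in> B" "0 \<le> t" "t \<le> 1" for t x
    using h(2) lL[OF that(1)] unit[OF that] by blast
  have cases: "x v = 0 \<or> x \<in> B \<and> 0 < x v \<or> 1/2 < x v" if "x \<in> ?X" for x
  proof -
    have "0 \<le> x v" "supp x \<in> K" using that by (auto simp: points_def)
    then show ?thesis using that by (auto simp: B_def insert_absorb not_le)
  qed
  have m_B: "m (t, x) = (\<lambda>u. (1 - 2 * x v) * h (2 * t * x v, l x) u + 2 * x v * e u)" if "x \<in> B" for t x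
    using h0[OF lL[OF that]] that l_id[of x] by (auto simp: m_def B_def)
  have r_B: "r x = h (2 * x v, l x)" if "x \<in> B" for x
    using h0[OF lL[OF that]] that l_id[of x] by (auto simp: r_def B_def)
  have m_C: "m (t, x) = e" if "1/2 \<le> x v" for t x
  proof (cases "x v = 1/2")
    case True
    then have "2 * x v = 1" by simp
    then show ?thesis unfolding m_def by simp
  qed (use that in \<open>auto simp: m_def\<close>)
  have r_C: "r x = c" if "x \<in> ?X" "1/2 \<le> x v" for x
  proof (cases "x v = 1/2")
    case True
    then have "x \<in> B" using cases[OF that(1)] by auto
    moreover have "2 * x v = 1" using True by simp
    ultimately show ?thesis using h1[OF lL] r_B by metis
  qed (use that in \<open>auto simp: r_def\<close>)
  have mX: "m (t, x) \<in> ?X" if "x \<in> ?X" "0 \<le> t" "t \<le> 1" for t x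
    using cases[OF that(1)]
  proof (elim disjE conjE)
    assume x: "x \<in> B" "0 < x v"
    have "(\<lambda>u. (1 - 2 * x v) * h (2 * t * x v, l x) u + 2 * x v * e u) \<in> ?X"
      using L[OF hL[OF x(1) that(2,3)]] eX x by (intro points_convex[OF K]) (auto simp: B_def)
    then show ?thesis using m_B[OF x(1)] by simp
  qed (use that eX in \<open>auto simp: m_def\<close>)
  have rX: "r x \<in> points (deletion K v)" if "x \<in> ?X" for x
    using cases[OF that]
  proof (elim disjE conjE)
    assume x: "x \<in> B" "0 < x v"
    show ?thesis using L[OF hL[OF x(1), of 1]] x by (simp add: r_B points_deletion)
  next
    assume "1/2 < x v"
    then show ?thesis using L[OF cL] that by (simp add: r_C points_deletion)
  qed (use that in \<open>auto simp: r_def points_deletion\<close>)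
  have "closed {x. insert v (supp x) \<in> K}"
  proof -
    have "insert v (supp x) \<in> K \<longleftrightarrow> (\<exists>S\<in>K. v \<in> S \<and> (\<forall>u. u \<notin> S \<longrightarrow> x u = 0))" for x :: "'a \<Rightarrow> real"
    proof
      assume "insert v (supp x) \<in> K"
      then show "\<exists>S\<in>K. v \<in> S \<and> (\<forall>u. u \<notin> S \<longrightarrow> x u = 0)"
        by (intro bexI[of _ "insert v (supp x)"]) auto
    next
      assume "\<exists>S\<in>K. v \<in> S \<and> (\<forall>u. u \<notin> S \<longrightarrow> x u = 0)"
      then obtain S where "S \<in> K" "insert v (supp x) \<subseteq> S" by blast
      then show "insert v (supp x) \<in> K" by (rule finite_complex_subset[OF K])
    qed
    then have eq: "{x. insert v (supp x) \<in> K} = (\<Union>S\<in>{S\<in>K. v \<in> S}. {x. \<forall>u. u \<notin> S \<longrightarrow> x u = 0})"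
      by auto
    have "finite {S\<in>K. v \<in> S}"
      by (rule finite_subset[of _ "Pow (\<Union>K)"]) (use fin in auto)
    then show ?thesis unfolding eq by (intro closed_UN ballI closed_coordinates)
  qed
  then have closedB: "closed ({x. insert v (supp x) \<in> K} \<inter> {x. x v \<le> 1/2})" (is "closed ?B")
    by (intro closed_Int closed_coordinates)
  let ?A = "{x :: 'a \<Rightarrow> real. x v = 0}" and ?C = "{x :: 'a \<Rightarrow> real. 1/2 \<le> x v}"
  have glue: "continuous_on ({0..1::real} \<times> ?X) \<phi>"
    if "continuous_on ({0..1} \<times> {x\<in>?X. x v = 0}) \<phi>" "continuous_on ({0..1} \<times> B) \<phi>"
      "continuous_on ({0..1} \<times> {x\<in>?X. 1/2 \<le> x v}) \<phi>" for \<phi> :: "real \<times> ('a \<Rightarrow> real) \<Rightarrow> 'a \<Rightarrow> real"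
  proof (rule continuous_on_closed_pieces)
    show "closed (UNIV \<times> ?A :: (real \<times> ('a \<Rightarrow> real)) set)"
      by (rule closed_Times[OF closed_UNIV closed_coordinates(1)])
    show "closed (UNIV \<times> (?B \<union> ?C) :: (real \<times> ('a \<Rightarrow> real)) set)"
      by (rule closed_Times[OF closed_UNIV closed_Un[OF closedB closed_coordinates(3)]])
    show "{0..1::real} \<times> ?X \<subseteq> UNIV \<times> ?A \<union> UNIV \<times> (?B \<union> ?C)"
      using cases by (force simp: B_def)
    show "continuous_on ({0..1} \<times> ?X \<inter> UNIV \<times> ?A) \<phi>"
      using that(1) by (rule continuous_on_subset) auto
    show "continuous_on ({0..1} \<times> ?X \<inter> UNIV \<times> (?B \<union> ?C)) \<phi>"
    proof (rule continuous_on_closed_pieces)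
      show "closed (UNIV \<times> ?B :: (real \<times> ('a \<Rightarrow> real)) set)"
        by (rule closed_Times[OF closed_UNIV closedB])
      show "closed (UNIV \<times> ?C :: (real \<times> ('a \<Rightarrow> real)) set)"
        by (rule closed_Times[OF closed_UNIV closed_coordinates(3)])
      show "continuous_on ({0..1} \<times> ?X \<inter> UNIV \<times> (?B \<union> ?C) \<inter> UNIV \<times> ?B) \<phi>"
        using that(2) by (rule continuous_on_subset) (auto simp: B_def)
      show "continuous_on ({0..1} \<times> ?X \<inter> UNIV \<times> (?B \<union> ?C) \<inter> UNIV \<times> ?C) \<phi>"
        using that(3) by (rule continuous_on_subset) auto
    qed auto
  qed
  have contm: "continuous_on ({0..1} \<times> ?X) m"
  proof (rule glue)
    show "continuous_on ({0..1} \<times> {x \<in> ?X. x v = 0}) m"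
      by (rule continuous_on_eq[of _ snd]) (auto simp: m_def intro: continuous_on_snd)
    show "continuous_on ({0..1} \<times> {x \<in> ?X. 1/2 \<le> x v}) m"
      by (rule continuous_on_eq[of _ "\<lambda>_. e"]) (auto simp: m_C)
    note c = continuous_on_product_then_coordinatewise[OF conthl]
    have "continuous_on ({0..1} \<times> B)
      (\<lambda>p u. (1 - 2 * snd p v) * h (2 * fst p * snd p v, l (snd p)) u + 2 * snd p v * e u)"
      by (rule continuous_on_coordinatewise_then_product)
        (intro continuous_on_add continuous_on_diff continuous_on_mult continuous_on_const cv2 c)
    then show "continuous_on ({0..1} \<times> B) m"
      by (rule continuous_on_eq) (auto simp: m_B)
  qed
  have contr: "continuous_on ?X r"
  proof -
    have "continuous_on ({0..1::real} \<times> ?X) (\<lambda>p. r (snd p))"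
    proof (rule glue)
      show "continuous_on ({0..1::real} \<times> {x \<in> ?X. x v = 0}) (\<lambda>p. r (snd p))"
        by (rule continuous_on_eq[of _ snd]) (auto simp: r_def intro: continuous_on_snd)
      show "continuous_on ({0..1::real} \<times> {x \<in> ?X. 1/2 \<le> x v}) (\<lambda>p. r (snd p))"
        by (rule continuous_on_eq[of _ "\<lambda>_. c"]) (auto simp: r_C)
      have "continuous_on ({0..1::real} \<times> B) (\<lambda>p. (1::real, snd p))"
        by (intro continuous_on_Pair continuous_on_const continuous_on_snd continuous_on_id)
      moreover have "(\<lambda>p. (1::real, snd p)) ` ({0..1::real} \<times> B) \<subseteq> {0..1} \<times> B" by auto
      ultimately have "continuous_on ({0..1::real} \<times> B) (\<lambda>p. h (2 * snd p v, l (snd p)))"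
        using continuous_on_compose2[OF conthl] by fastforce
      then show "continuous_on ({0..1::real} \<times> B) (\<lambda>p. r (snd p))"
        by (rule continuous_on_eq) (auto simp: r_B)
    qed
    moreover have "continuous_on ?X (\<lambda>x. (0::real, x))"
      by (intro continuous_on_Pair continuous_on_const continuous_on_id)
    moreover have "(\<lambda>x. (0::real, x)) ` ?X \<subseteq> {0..1} \<times> ?X" by auto
    ultimately show ?thesis
      using continuous_on_compose2 by fastforce
  qed
  have conts: "continuous_on ?X (\<lambda>x. m (t, x))" if "t \<in> {0..1}" for t
    by (rule continuous_on_compose2[OF contm]) (use that in \<open>auto intro: continuous_on_Pair\<close>)
  have supp_comb: "supp (\<lambda>u. (1 - s) * y u + s * e u) \<subseteq> insert v (supp y)" for s y
    by (auto simp: e_def)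
  \<comment> \<open>switching on the apex: the supports stay inside the closed star\<close>
  have hom1: "homotopic_with_canon (\<lambda>_. True) ?X ?X id (\<lambda>x. m (0, x))"
  proof (rule straight_line_homotopic[OF K])
    fix x assume x: "x \<in> ?X"
    show "supp (id x) \<union> supp (m (0, x)) \<in> K"
      using cases[OF x]
    proof (elim disjE conjE)
      assume xB: "x \<in> B" "0 < x v"
      have "supp (l x) \<subseteq> supp x" by (auto simp: l_def)
      then have "supp (id x) \<union> supp (m (0, x)) \<subseteq> insert v (supp x)"
        using supp_comb[of "2 * x v" "l x"] h0[OF lL[OF xB(1)]] by (auto simp: m_B[OF xB(1)])
      then show ?thesis using xB finite_complex_subset[OF K] by (auto simp: B_def)
    next
      assume "1/2 < x v"
      then have "supp (id x) \<union> supp (m (0, x)) = supp x" by (auto simp: m_C e_def)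
      then show ?thesis using x by (simp add: points_def)
    qed (use x in \<open>auto simp: m_def points_def\<close>)
  qed (use conts[of 0] mX[of _ 0] in \<open>auto\<close>)
  have hom2: "homotopic_with_canon (\<lambda>_. True) ?X ?X (\<lambda>x. m (0, x)) (\<lambda>x. m (1, x))"
    unfolding homotopic_on_iff using contm mX by (intro exI[of _ m]) auto
  \<comment> \<open>dropping the apex: the point of the link does not move\<close>
  have hom3: "homotopic_with_canon (\<lambda>_. True) ?X ?X (\<lambda>x. m (1, x)) r"
  proof (rule straight_line_homotopic[OF K])
    fix x assume x: "x \<in> ?X"
    show "supp (m (1, x)) \<union> supp (r x) \<in> K"
      using cases[OF x]
    proof (elim disjE conjE)
      assume xB: "x \<in> B" "0 < x v"
      have "supp (m (1, x)) \<union> supp (r x) \<subseteq> insert v (supp (h (2 * x v, l x)))"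
        using supp_comb[of "2 * x v" "h (2 * x v, l x)"] by (auto simp: m_B[OF xB(1)] r_B[OF xB(1)])
      then show ?thesis using L(3)[OF hL[OF xB(1), of 1]] finite_complex_subset[OF K] by auto
    next
      assume "1/2 < x v"
      then show ?thesis using x L(3)[OF cL] L(5)[OF cL] by (simp add: m_C r_C)
    qed (use x in \<open>auto simp: m_def r_def points_def\<close>)
  qed (use conts[of 1] mX[of _ 1] contr rX in \<open>auto simp: points_deletion\<close>)
  have hom: "homotopic_with_canon (\<lambda>_. True) ?X ?X r id"
    using homotopic_with_trans[OF homotopic_with_trans[OF hom1 hom2] hom3] homotopic_with_sym by blast
  show ?thesis
    unfolding homotopy_equivalent_space_def geometric_realization_eq
  proof (intro exI conjI)
    show "continuous_map (top_of_set ?X) (top_of_set (points (deletion K v))) r"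
      using contr rX by (auto simp: continuous_map_subtopology_eu)
    show "continuous_map (top_of_set (points (deletion K v))) (top_of_set ?X) id"
      by (auto simp: points_deletion)
    show "homotopic_with_canon (\<lambda>_. True) ?X ?X (id \<circ> r) id" using hom by simp
    show "homotopic_with_canon (\<lambda>_. True) (points (deletion K v)) (points (deletion K v)) (r \<circ> id) id"
      by (rule homotopic_with_equal)
        (auto simp: points_deletion r_def continuous_map_subtopology_eu
          intro: continuous_on_eq[of _ id])
  qed
qed

section \<open>Independence complexes and their vertices\<close>

text \<open>
  The property \<open>contractible_space\<close> holds of the empty space, which is a sphere here.
\<close>

definition pointlike :: "'a topology \<Rightarrow> bool" where
  "pointlike X \<longleftrightarrow> topspace X \<noteq> {} \<and> contractible_space X"

lemma homotopy_equivalent_empty_iff: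
  "X homotopy_equivalent_space Y \<Longrightarrow> topspace X = {} \<longleftrightarrow> topspace Y = {}"
  unfolding homotopy_equivalent_space_def continuous_map_def by blast

lemma pointlike_homotopy_equivalent:
  assumes "X homotopy_equivalent_space Y" shows "pointlike X \<longleftrightarrow> pointlike Y"
  using homotopy_equivalent_empty_iff[OF assms] homotopy_equivalent_space_contractibility[OF assms]
  by (simp add: pointlike_def)

definition indep :: "('a \<Rightarrow> 'a \<Rightarrow> bool) \<Rightarrow> 'a set \<Rightarrow> 'a set set" where
  "indep adj W = {S. S \<subseteq> W \<and> (\<forall>u\<in>S. \<forall>v\<in>S. \<not> adj u v)}"

definition ind_space :: "('a \<Rightarrow> 'a \<Rightarrow> bool) \<Rightarrow> 'a set \<Rightarrow> ('a \<Rightarrow> real) topology" where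
  "ind_space adj W = geometric_realization (indep adj W)"

definition simple_adj :: "('a \<Rightarrow> 'a \<Rightarrow> bool) \<Rightarrow> bool" where
  "simple_adj adj \<longleftrightarrow> (\<forall>u v. adj u v \<longrightarrow> adj v u) \<and> (\<forall>v. \<not> adj v v)"

definition non_nbrs :: "('a \<Rightarrow> 'a \<Rightarrow> bool) \<Rightarrow> 'a set \<Rightarrow> 'a \<Rightarrow> 'a set" where
  "non_nbrs adj W v = {u \<in> W. u \<noteq> v \<and> \<not> adj v u}"

lemma finite_complex_indep: "finite W \<Longrightarrow> finite_complex (indep adj W)"
  by (auto simp: finite_complex_def indep_def intro: finite_subset[of _ W])

lemma link_indep:
  assumes "simple_adj adj" "v \<in> W" shows "link (indep adj W) v = indep adj (non_nbrs adj W v)"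
  using assms by (auto simp: link_def indep_def non_nbrs_def simple_adj_def)

lemma deletion_indep: "deletion (indep adj W) v = indep adj (W - {v})"
  by (auto simp: deletion_def indep_def)

lemma delete_vertex:
  assumes "simple_adj adj" "finite W" "v \<in> W" "pointlike (ind_space adj (non_nbrs adj W v))"
  shows "ind_space adj W homotopy_equivalent_space ind_space adj (W - {v})"
  using delete_vertex_contractible_link[OF finite_complex_indep, of W adj v] assms
  by (simp add: ind_space_def link_indep deletion_indep pointlike_def geometric_realization_eq)

text \<open>
  An isolated vertex can be added to any independent set, so the complex is a cone with this apex.
\<close>

lemma isolated_pointlike:
  assumes W: "finite W" and v: "v \<in> W" "\<And>u. u \<in> W \<Longrightarrow> \<not> adj v u \<and> \<not> adj u v"
  shows "pointlike (ind_space adj W)"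
proof -
  define e where "e = (\<lambda>u. if u = v then 1 else 0 :: real)"
  have supp_e: "supp e = {v}" by (auto simp: e_def)
  have e: "e \<in> points (indep adj W)"
  proof -
    have "{v} \<in> indep adj W" using v by (auto simp: indep_def)
    moreover have "(\<Sum>u | e u \<noteq> 0. e u) = 1" unfolding supp_e by (simp add: e_def)
    moreover have "0 \<le> e u" for u by (simp add: e_def)
    ultimately show ?thesis unfolding points_def mem_Collect_eq supp_e by blast
  qed
  have "homotopic_with_canon (\<lambda>_. True) (points (indep adj W)) (points (indep adj W)) id (\<lambda>_. e)"
  proof (rule straight_line_homotopic[OF finite_complex_indep[OF W]])
    fix x assume "x \<in> points (indep adj W)"
    then show "supp (id x) \<union> supp e \<in> indep adj W"
      using v by (auto simp: points_def supp_e indep_def)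
  qed (use e in auto)
  then show ?thesis
    using e unfolding pointlike_def ind_space_def geometric_realization_eq contractible_space_def by auto
qed

text \<open>
  If every neighbour of \<open>u\<close> is a neighbour of \<open>v\<close>, then \<open>u\<close> is isolated in the graph without
  \<open>v\<close> and its neighbours, so that the link of \<open>v\<close> is a cone.
\<close>

lemma delete_dominating:
  assumes "simple_adj adj" "finite W" "u \<in> W" "v \<in> W" "u \<noteq> v" "\<And>x. x \<in> W \<Longrightarrow> adj u x \<Longrightarrow> adj v x"
  shows "ind_space adj W homotopy_equivalent_space ind_space adj (W - {v})"
proof (rule delete_vertex[OF assms(1,2,4)])
  have "\<not> adj v u" using assms by (auto simp: simple_adj_def)
  then show "pointlike (ind_space adj (non_nbrs adj W v))"
    using assms by (intro isolated_pointlike[of _ u]) (auto simp: non_nbrs_def simple_adj_def)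
qed

lemma delete_dominating_set:
  assumes "simple_adj adj" "finite W" "u \<in> W" "U \<subseteq> W - {u}"
    "\<And>x v. x \<in> W \<Longrightarrow> adj u x \<Longrightarrow> v \<in> U \<Longrightarrow> adj v x"
  shows "ind_space adj W homotopy_equivalent_space ind_space adj (W - U)"
proof -
  have "finite U" using assms by (meson finite_Diff finite_subset)
  then show ?thesis using assms(4,5)
  proof (induction U)
    case empty then show ?case by (simp add: homotopy_equivalent_space_refl)
  next
    case (insert v U)
    then have "ind_space adj W homotopy_equivalent_space ind_space adj (W - U)" by auto
    moreover have "ind_space adj (W - U) homotopy_equivalent_space ind_space adj (W - U - {v})"
      by (rule delete_dominating[of _ _ u]) (use insert assms(1-3) in auto)
    moreover have "W - U - {v} = W - insert v U" by auto
    ultimately show ?case using homotopy_eqv_trans by metis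
  qed
qed

lemma ind_space_cong:
  assumes "\<And>u v. u \<in> W \<Longrightarrow> v \<in> W \<Longrightarrow> adj u v \<longleftrightarrow> adj' u v"
  shows "ind_space adj W = ind_space adj' W"
proof -
  have "indep adj W = indep adj' W" using assms unfolding indep_def by (auto; blast)
  then show ?thesis by (simp add: ind_space_def)
qed

lemma ind_space_relabel:
  fixes f :: "'a \<Rightarrow> 'b"
  assumes W: "finite W" and f: "inj_on f W"
    and adj: "\<And>u v. u \<in> W \<Longrightarrow> v \<in> W \<Longrightarrow> adj' (f u) (f v) \<longleftrightarrow> adj u v"
  shows "ind_space adj W homotopy_equivalent_space ind_space adj' (f ` W)"
proof (rule homeomorphic_imp_homotopy_equivalent_space)
  define to where "to x = (\<lambda>y. if y \<in> f ` W then x (the_inv_into W f y) else 0)" for x :: "'a \<Rightarrow> real"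
  define ret where "ret y = (\<lambda>w. if w \<in> W then y (f w) else 0)" for y :: "'b \<Rightarrow> real"
  have to_f: "to x (f w) = x w" if "w \<in> W" for x w
    using that f by (simp add: to_def the_inv_into_f_f)
  have indep_iff: "f ` S \<in> indep adj' (f ` W) \<longleftrightarrow> S \<in> indep adj W" if "S \<subseteq> W" for S
    using that adj by (auto simp: indep_def subset_iff)
  have W': "finite W" "\<Union>(indep adj W) \<subseteq> W" "finite (f ` W)" "\<Union>(indep adj' (f ` W)) \<subseteq> f ` W"
    using W by (auto simp: indep_def)
  have in_W: "supp x \<subseteq> W" if "x \<in> points (indep adj W)" for x
    using that by (auto simp: points_def indep_def)
  have in_fW: "supp y \<subseteq> f ` W" if "y \<in> points (indep adj' (f ` W))" for y
    using that by (auto simp: points_def indep_def)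
  have to: "to x \<in> points (indep adj' (f ` W))" if x: "x \<in> points (indep adj W)" for x
  proof -
    have "supp (to x) = f ` supp x"
      using in_W[OF x] to_f by (auto simp: image_iff to_def subset_iff) (metis the_inv_into_f_f f)+
    moreover have "sum (to x) (f ` W) = sum x W" using f by (simp add: sum.reindex to_f)
    moreover have "0 \<le> to x v" for v using x by (auto simp: to_def points_def)
    ultimately show ?thesis
      using x in_W[OF x] indep_iff by (simp add: points_iff[OF W'(1,2)] points_iff[OF W'(3,4)])
  qed
  have ret: "ret y \<in> points (indep adj W)" if y: "y \<in> points (indep adj' (f ` W))" for y
  proof -
    have "f ` supp (ret y) = supp y" using in_fW[OF y] by (auto simp: ret_def)
    moreover have "supp (ret y) \<subseteq> W" by (auto simp: ret_def)
    moreover have "sum (ret y) W = sum y (f ` W)" using f by (simp add: sum.reindex ret_def)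
    moreover have "0 \<le> ret y v" for v using y by (auto simp: ret_def points_def)
    ultimately show ?thesis
      using y indep_iff[of "supp (ret y)"] by (simp add: points_iff[OF W'(1,2)] points_iff[OF W'(3,4)])
  qed
  have "homeomorphic_maps (ind_space adj W) (ind_space adj' (f ` W)) to ret"
    unfolding homeomorphic_maps_def ind_space_def geometric_realization_eq continuous_map_subtopology_eu
  proof (intro conjI ballI)
    show "continuous_on (points (indep adj W)) to"
    proof (rule continuous_on_coordinatewise_then_product)
      fix y show "continuous_on (points (indep adj W)) (\<lambda>x. to x y)"
        by (cases "y \<in> f ` W") (auto simp: to_def intro: continuous_on_subset[OF continuous_on_product_coordinates])
    qed
    show "continuous_on (points (indep adj' (f ` W))) ret"
    proof (rule continuous_on_coordinatewise_then_product)
      fix w show "continuous_on (points (indep adj' (f ` W))) (\<lambda>y. ret y w)"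
        by (cases "w \<in> W") (auto simp: ret_def intro: continuous_on_subset[OF continuous_on_product_coordinates])
    qed
    fix x assume "x \<in> topspace (top_of_set (points (indep adj W)))"
    then have "supp x \<subseteq> W" using in_W by simp
    then show "ret (to x) = x" by (auto simp: ret_def to_f fun_eq_iff)
  next
    fix y assume "y \<in> topspace (top_of_set (points (indep adj' (f ` W))))"
    then have "supp y \<subseteq> f ` W" using in_fW by simp
    then show "to (ret y) = y"
      by (auto simp: to_def ret_def the_inv_into_f_f[OF f] fun_eq_iff)
  qed (use to ret in auto)
  then show "ind_space adj W homeomorphic_space ind_space adj' (f ` W)"
    by (auto simp: homeomorphic_space_def)
qed


section \<open>Suspension by disjoint edges\<close>

text \<open>
  On the right summand the vertices \<open>2 i\<close> and \<open>2 i + 1\<close> form an edge, for every \<open>i\<close>.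
\<close>

fun sum_adj :: "('a \<Rightarrow> 'a \<Rightarrow> bool) \<Rightarrow> 'a + nat \<Rightarrow> 'a + nat \<Rightarrow> bool" where
  "sum_adj adj (Inl u) (Inl v) = adj u v"
| "sum_adj adj (Inr i) (Inr j) = (i div 2 = j div 2 \<and> i \<noteq> j)"
| "sum_adj adj _ _ = False"

definition with_edges :: "'a set \<Rightarrow> nat \<Rightarrow> ('a + nat) set" where
  "with_edges V k = Inl ` V \<union> Inr ` {..<2 * k}"

definition susp_space :: "('a \<Rightarrow> 'a \<Rightarrow> bool) \<Rightarrow> 'a set \<Rightarrow> nat \<Rightarrow> ('a + nat \<Rightarrow> real) topology" where
  "susp_space adj V k = ind_space (sum_adj adj) (with_edges V k)"

lemma simple_sum_adj: "simple_adj adj \<Longrightarrow> simple_adj (sum_adj adj)"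
  unfolding simple_adj_def
proof (intro conjI allI impI)
  assume a: "(\<forall>u v. adj u v \<longrightarrow> adj v u) \<and> (\<forall>v. \<not> adj v v)"
  show "sum_adj adj v u" if "sum_adj adj u v" for u v
    using a that by (cases u; cases v) auto
  show "\<not> sum_adj adj v v" for v using a by (cases v) auto
qed

lemma finite_with_edges: "finite V \<Longrightarrow> finite (with_edges V k)"
  by (simp add: with_edges_def)

lemma susp_delete:
  assumes "simple_adj adj" "finite V" "v \<in> V" "pointlike (susp_space adj (non_nbrs adj V v) k)"
  shows "susp_space adj V k homotopy_equivalent_space susp_space adj (V - {v}) k"
proof -
  have "non_nbrs (sum_adj adj) (with_edges V k) (Inl v) = with_edges (non_nbrs adj V v) k"
    by (auto simp: non_nbrs_def with_edges_def)
  moreover have "with_edges V k - {Inl v} = with_edges (V - {v}) k"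
    by (auto simp: with_edges_def)
  ultimately show ?thesis
    using delete_vertex[OF simple_sum_adj, of adj "with_edges V k" "Inl v"] assms
    by (auto simp: susp_space_def finite_with_edges) (simp add: with_edges_def)
qed

lemma susp_isolated:
  assumes "simple_adj adj" "finite V" "v \<in> V" "\<And>u. u \<in> V \<Longrightarrow> \<not> adj v u"
  shows "pointlike (susp_space adj V k)"
proof -
  have "\<not> adj u v" if "u \<in> V" for u using assms that by (auto simp: simple_adj_def)
  then show ?thesis
    unfolding susp_space_def
    by (intro isolated_pointlike[of _ "Inl v"]) (use assms in \<open>auto simp: with_edges_def\<close>)
qed

text \<open>
  Attach a leaf \<open>s\<close> to \<open>v\<close>.  Its link is the deletion of \<open>v\<close>, so that adding it does not change
  the homotopy type.  Now \<open>s\<close> is dominated by all other neighbours of \<open>v\<close>; deleting those leaves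
  the edge \<open>sv\<close> as a component of its own.  In the proof \<open>v\<close> is renamed to \<open>t\<close>, so that \<open>st\<close> is
  the next one of the edges on the right summand.
\<close>

lemma susp_step:
  assumes adj: "simple_adj adj" and V: "finite V" "v \<in> V"
    and pt: "pointlike (susp_space adj (V - {v}) k)"
  shows "susp_space adj V k homotopy_equivalent_space susp_space adj (non_nbrs adj V v) (Suc k)"
proof -
  define s where "s = (Inr (2 * k) :: 'a + nat)"
  define t where "t = (Inr (2 * k + 1) :: 'a + nat)"
  define f where "f x = (if x = Inl v then t else x)" for x
  define g where "g x = (if x = t then Inl v else x)" for x
  define \<gamma> where "\<gamma> x y \<longleftrightarrow> sum_adj adj (g x) (g y) \<or> {x, y} = {s, t}" for x y
  let ?W = "with_edges (V - {v}) (Suc k)"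
  have st: "s \<noteq> t" "g s = s" "g t = Inl v" "\<And>u. Inl u \<noteq> s" "\<And>u. Inl u \<noteq> t" by (auto simp: s_def t_def g_def)
  have simple: "simple_adj \<gamma>"
    using simple_sum_adj[OF adj] st unfolding simple_adj_def \<gamma>_def by (auto simp: doubleton_eq_iff)
  have W: "?W = with_edges (V - {v}) k \<union> {s, t}"
    by (auto simp: with_edges_def s_def t_def less_Suc_eq)
  have notin: "s \<notin> with_edges U k" "t \<notin> with_edges U k" for U
    by (auto simp: with_edges_def s_def t_def)
  have finW: "finite ?W" using V by (simp add: finite_with_edges)
  have \<gamma>_s: "\<gamma> s x \<longleftrightarrow> x = t" if "x \<in> ?W" for x
    using that st unfolding \<gamma>_def W
    by (auto simp: doubleton_eq_iff with_edges_def g_def s_def t_def split: if_splits)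
  have "non_nbrs \<gamma> ?W s = with_edges (V - {v}) k"
    unfolding non_nbrs_def using \<gamma>_s notin W by auto
  moreover have "ind_space \<gamma> (with_edges (V - {v}) k) = susp_space adj (V - {v}) k"
    unfolding susp_space_def
    by (rule ind_space_cong) (use notin in \<open>auto simp: \<gamma>_def g_def doubleton_eq_iff\<close>)
  ultimately have "ind_space \<gamma> ?W homotopy_equivalent_space ind_space \<gamma> (?W - {s})"
    using pt by (intro delete_vertex[OF simple finW]) (auto simp: W)
  moreover have "susp_space adj V k homotopy_equivalent_space ind_space \<gamma> (f ` with_edges V k)"
    unfolding susp_space_def
  proof (rule ind_space_relabel)
    show "inj_on f (with_edges V k)" using notin[of V] by (auto simp: inj_on_def f_def split: if_splits)
    fix x y assume xy: "x \<in> with_edges V k" "y \<in> with_edges V k"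
    then have "g (f x) = x" "g (f y) = y" "f x \<noteq> s" "f y \<noteq> s"
      using notin[of V] st by (auto simp: g_def f_def)
    then show "\<gamma> (f x) (f y) \<longleftrightarrow> sum_adj adj x y" by (auto simp: \<gamma>_def doubleton_eq_iff)
  qed (use V in \<open>simp add: finite_with_edges\<close>)
  moreover have "f ` with_edges V k = ?W - {s}"
  proof -
    have "with_edges V k = insert (Inl v) (with_edges (V - {v}) k)" using V by (auto simp: with_edges_def)
    moreover have "f ` with_edges (V - {v}) k = with_edges (V - {v}) k"
      by (rule image_cong[where g = id, simplified]) (auto simp: f_def with_edges_def)
    ultimately show ?thesis unfolding W using notin[of "V - {v}"] st by (auto simp: f_def)
  qed
  moreover have "ind_space \<gamma> ?W homotopy_equivalent_space ind_space \<gamma> (?W - Inl ` {u \<in> V. adj v u})"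
  proof (rule delete_dominating_set[OF simple finW, of s])
    show "s \<in> ?W" by (simp add: W)
    show "Inl ` {u \<in> V. adj v u} \<subseteq> ?W - {s}"
      using adj st by (auto simp: W with_edges_def simple_adj_def)
    fix x w :: "'a + nat" assume "x \<in> ?W" "\<gamma> s x" "w \<in> Inl ` {u \<in> V. adj v u}"
    then show "\<gamma> w x" using \<gamma>_s adj st by (auto simp: \<gamma>_def g_def simple_adj_def)
  qed
  moreover have "?W - Inl ` {u \<in> V. adj v u} = with_edges (non_nbrs adj V v) (Suc k)"
    by (auto simp: with_edges_def non_nbrs_def)
  moreover have "ind_space \<gamma> (with_edges (non_nbrs adj V v) (Suc k)) = susp_space adj (non_nbrs adj V v) (Suc k)"
    unfolding susp_space_def
  proof (rule ind_space_cong)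
    have st_adj: "sum_adj adj x t \<longleftrightarrow> x = s" "sum_adj adj t x \<longleftrightarrow> x = s" for x
      by (cases x; auto simp: s_def t_def; presburger)+
    have v: "\<not> sum_adj adj x (Inl v) \<and> \<not> sum_adj adj (Inl v) x" if "x \<in> with_edges (non_nbrs adj V v) (Suc k)" for x
      using that adj by (auto simp: with_edges_def non_nbrs_def simple_adj_def)
    fix x y assume "x \<in> with_edges (non_nbrs adj V v) (Suc k)" "y \<in> with_edges (non_nbrs adj V v) (Suc k)"
    then show "\<gamma> x y \<longleftrightarrow> sum_adj adj x y"
      using v[of x] v[of y] st_adj adj st by (auto simp: \<gamma>_def g_def doubleton_eq_iff simple_adj_def)
  qed
  ultimately show ?thesis
    using homotopy_equivalent_space_sym homotopy_eqv_trans by metis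
qed

section \<open>Cross polytopes and spheres\<close>

lemma sum_pairs: "sum f {..<2 * n} = (\<Sum>i<n. f (2 * i) + f (2 * i + 1))" for f :: "nat \<Rightarrow> real"
  by (induction n) (auto simp: algebra_simps)

text \<open>
  A face contains at most one end of every edge, as for a polytope with \<open>n\<close> pairs of antipodal
  vertices.
\<close>

lemma cross_polytope_points:
  "x \<in> points (indep (sum_adj adj) (with_edges {} n)) \<longleftrightarrow>
    (\<forall>v. 0 \<le> x v) \<and> (\<forall>u. x (Inl u) = 0) \<and> (\<forall>j\<ge>2 * n. x (Inr j) = 0)
    \<and> (\<forall>i<n. x (Inr (2 * i)) = 0 \<or> x (Inr (2 * i + 1)) = 0)
    \<and> (\<Sum>i<n. x (Inr (2 * i)) + x (Inr (2 * i + 1))) = 1" (is "?l \<longleftrightarrow> ?r")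
proof -
  have W: "finite (with_edges {} n)" "\<Union>(indep (sum_adj adj) (with_edges {} n)) \<subseteq> with_edges {} n"
    by (auto simp: with_edges_def indep_def)
  have s: "sum x (with_edges {} n) = (\<Sum>i<n. x (Inr (2 * i)) + x (Inr (2 * i + 1)))"
    using sum_pairs[of "\<lambda>j. x (Inr j)" n] by (simp add: with_edges_def sum.reindex)
  have "supp x \<in> indep (sum_adj adj) (with_edges {} n) \<longleftrightarrow>
    (\<forall>u. x (Inl u) = 0) \<and> (\<forall>j\<ge>2 * n. x (Inr j) = 0) \<and> (\<forall>i<n. x (Inr (2 * i)) = 0 \<or> x (Inr (2 * i + 1)) = 0)"
    (is "?a \<longleftrightarrow> ?b")
  proof
    assume ?a
    then have sub: "supp x \<subseteq> Inr ` {..<2 * n}"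
      and ind: "\<And>u v. x u \<noteq> 0 \<Longrightarrow> x v \<noteq> 0 \<Longrightarrow> \<not> sum_adj adj u v"
      by (auto simp: indep_def with_edges_def)
    have "x (Inl u) = 0" for u using sub by auto
    moreover have "x (Inr j) = 0" if "j \<ge> 2 * n" for j using sub that by force
    moreover have "x (Inr (2 * i)) = 0 \<or> x (Inr (2 * i + 1)) = 0" for i
      using ind[of "Inr (2 * i)" "Inr (2 * i + 1)"] by auto
    ultimately show ?b by blast
  next
    assume b: ?b
    have "v \<in> with_edges {} n" if "x v \<noteq> 0" for v
    proof (cases v)
      case (Inr j)
      then have "j < 2 * n" using b that by (meson not_le)
      then show ?thesis using Inr by (simp add: with_edges_def)
    qed (use b that in simp)
    moreover have "\<not> sum_adj adj u v" if uv: "x u \<noteq> 0" "x v \<noteq> 0" for u v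
    proof
      assume a: "sum_adj adj u v"
      then obtain j k where jk: "u = Inr j" "v = Inr k" "j div 2 = k div 2" "j \<noteq> k"
        using b uv by (cases u; cases v) auto
      define i where "i = j div 2"
      have "j < 2 * n" using b uv jk by (meson not_le)
      then have "i < n" by (simp add: i_def)
      moreover have "{j, k} = {2 * i, 2 * i + 1}" using jk(3,4) unfolding i_def by auto
      ultimately show False using b uv jk by (auto simp: doubleton_eq_iff)
    qed
    ultimately show ?a by (auto simp: indep_def)
  qed
  then show ?thesis using s by (auto simp: points_iff[OF W])
qed

text \<open>
  Subtracting the coordinates of antipodal vertices maps the complex onto the unit sphere of the
  \<open>l1\<close> norm, with inverse given by positive and negative parts; rescaling carries this sphere to
  the Euclidean one.
\<close>

lemma cross_polytope_sphere:
  "susp_space adj {} n homotopy_equivalent_space sphere_space (int n - 1)"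
proof (cases "n = 0")
  case True
  have "points (indep (sum_adj adj) (with_edges {} 0)) = {}"
    using cross_polytope_points[of _ adj 0] by auto
  then have "susp_space adj {} n = trivial_topology"
    using True by (simp add: susp_space_def ind_space_def geometric_realization_eq)
  moreover have "(trivial_topology :: ('a + nat \<Rightarrow> real) topology) homotopy_equivalent_space
      (trivial_topology :: (nat \<Rightarrow> real) topology)"
    unfolding homotopy_equivalent_space_def by (intro exI conjI homotopic_with_equal) auto
  ultimately show ?thesis using True by (simp add: sphere_space_def)
next
  case False
  let ?P = "points (indep (sum_adj adj) (with_edges {} n))"
  let ?S = "{z :: nat \<Rightarrow> real. (\<Sum>i<n. (z i)\<^sup>2) = 1 \<and> (\<forall>i\<ge>n. z i = 0)}"
  have "{..n - 1} = {..<n}" "\<And>i. i > n - 1 \<longleftrightarrow> i \<ge> n" using False by auto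
  then have sphere: "sphere_space (int n - 1) = top_of_set ?S"
    using False by (simp add: sphere_space_def nsphere nat_diff_distrib flip: euclidean_product_topology)
  define d where "d x i = x (Inr (2 * i)) - x (Inr (2 * i + 1))" for x :: "'a + nat \<Rightarrow> real" and i
  define l2 where "l2 z = sqrt (\<Sum>i<n. (z i)\<^sup>2)" for z :: "nat \<Rightarrow> real"
  define l1 where "l1 z = (\<Sum>i<n. \<bar>z i\<bar>)" for z :: "nat \<Rightarrow> real"
  define to where "to x i = (if i < n then d x i / l2 (d x) else 0)" for x i
  define ret where "ret z v = (case v of Inl u \<Rightarrow> 0 | Inr j \<Rightarrow>
    if j < 2 * n then max 0 (if even j then z (j div 2) else - z (j div 2)) / l1 z else 0)"
    for z and v :: "'a + nat"
  have P: "0 \<le> x v" "x (Inl u) = 0" "j \<ge> 2 * n \<Longrightarrow> x (Inr j) = 0"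
    "i < n \<Longrightarrow> x (Inr (2 * i)) = 0 \<or> x (Inr (2 * i + 1)) = 0"
    "(\<Sum>i<n. x (Inr (2 * i)) + x (Inr (2 * i + 1))) = 1" if "x \<in> ?P" for x v u i j
    using that by (auto simp: cross_polytope_points)
  have l1_d: "l1 (d x) = 1" if "x \<in> ?P" for x
  proof -
    have "\<bar>d x i\<bar> = x (Inr (2 * i)) + x (Inr (2 * i + 1))" if "i < n" for i
      using P(4)[OF \<open>x \<in> ?P\<close> that] P(1)[OF \<open>x \<in> ?P\<close>, of "Inr (2 * i)"] P(1)[OF \<open>x \<in> ?P\<close>, of "Inr (2 * i + 1)"]
      by (auto simp: d_def)
    then show ?thesis using P(5)[OF that] by (simp add: l1_def)
  qed
  have l2_pos: "l2 z > 0" if "l1 z \<noteq> 0" for z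
  proof -
    have "\<exists>i<n. z i \<noteq> 0" by (rule ccontr) (use that in \<open>simp add: l1_def\<close>)
    then obtain i where "i < n" "z i \<noteq> 0" by blast
    then have "(\<Sum>i<n. (z i)\<^sup>2) > 0" by (intro sum_pos2[of _ i]) auto
    then show ?thesis by (simp add: l2_def)
  qed
  have l1_pos: "l1 z > 0" if "z \<in> ?S" for z
  proof -
    have "\<exists>i<n. z i \<noteq> 0" by (rule ccontr) (use that in simp)
    then obtain i where "i < n" "z i \<noteq> 0" by blast
    then show ?thesis unfolding l1_def by (intro sum_pos2[of _ i]) auto
  qed
  have l2_to: "(\<Sum>i<n. (to x i)\<^sup>2) = 1" and l1_to: "l1 (to x) = 1 / l2 (d x)" if "x \<in> ?P" for x
  proof -
    have pos: "l2 (d x) > 0" using l2_pos l1_d[OF that] by simp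
    have "(\<Sum>i<n. (to x i)\<^sup>2) = (\<Sum>i<n. (d x i)\<^sup>2) / (l2 (d x))\<^sup>2"
      by (simp add: to_def power_divide sum_divide_distrib)
    also have "(l2 (d x))\<^sup>2 = (\<Sum>i<n. (d x i)\<^sup>2)" by (simp add: l2_def sum_nonneg)
    finally show "(\<Sum>i<n. (to x i)\<^sup>2) = 1" using pos by (auto simp: l2_def)
    have "l1 (to x) = l1 (d x) / l2 (d x)"
      using pos by (simp add: l1_def to_def sum_divide_distrib)
    then show "l1 (to x) = 1 / l2 (d x)" using l1_d[OF that] by simp
  qed
  have max_diff: "max 0 a - max 0 (- a) = a" "max 0 a + max 0 (- a) = \<bar>a\<bar>" for a :: real by auto
  have d_from: "d (ret z) i = z i / l1 z" and s_from: "ret z (Inr (2 * i)) + ret z (Inr (2 * i + 1)) = \<bar>z i\<bar> / l1 z"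
    if "i < n" for z i
    using that max_diff[of "z i"] by (simp_all add: d_def ret_def flip: diff_divide_distrib add_divide_distrib)
  have to: "to x \<in> ?S" if "x \<in> ?P" for x using l2_to[OF that] by (simp add: to_def)
  have ret: "ret z \<in> ?P" if "z \<in> ?S" for z
    unfolding cross_polytope_points
  proof (intro conjI allI impI)
    show "0 \<le> ret z v" for v using l1_pos[OF that] by (auto simp: ret_def split: sum.split)
    show "ret z (Inr (2 * i)) = 0 \<or> ret z (Inr (2 * i + 1)) = 0" if "i < n" for i
      by (auto simp: ret_def)
    have "(\<Sum>i<n. ret z (Inr (2 * i)) + ret z (Inr (2 * i + 1))) = (\<Sum>i<n. \<bar>z i\<bar> / l1 z)"
      using s_from by (intro sum.cong) auto
    also have "\<dots> = l1 z / l1 z" by (simp only: l1_def sum_divide_distrib)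
    finally show "(\<Sum>i<n. ret z (Inr (2 * i)) + ret z (Inr (2 * i + 1))) = 1"
      using l1_pos[OF that] by simp
  qed (auto simp: ret_def)
  have contx: "continuous_on A (\<lambda>x. x v)" for A :: "('c \<Rightarrow> real) set" and v
    by (rule continuous_on_subset[OF continuous_on_product_coordinates]) simp
  have "homeomorphic_maps (susp_space adj {} n) (sphere_space (int n - 1)) to ret"
    unfolding homeomorphic_maps_def sphere susp_space_def ind_space_def geometric_realization_eq
      continuous_map_subtopology_eu
  proof (intro conjI ballI)
    have "l2 (d x) \<noteq> 0" if "x \<in> ?P" for x using l2_pos[of "d x"] l1_d[OF that] by simp
    then have "continuous_on ?P (\<lambda>x. d x i / l2 (d x))" for i
      unfolding d_def l2_def by (intro continuous_intros contx) auto
    then have "continuous_on ?P (\<lambda>x. to x i)" for i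
      unfolding to_def by (cases "i < n") auto
    then show "continuous_on ?P to" by (rule continuous_on_coordinatewise_then_product)
    have "l1 z \<noteq> 0" if "z \<in> ?S" for z using l1_pos[OF that] by simp
    then have c: "continuous_on ?S (\<lambda>z. max 0 (z i) / l1 z)" "continuous_on ?S (\<lambda>z. max 0 (- z i) / l1 z)" for i
      unfolding l1_def by (intro continuous_intros contx; auto)+
    have "continuous_on ?S (\<lambda>z. ret z v)" for v
    proof (cases v)
      case (Inr j)
      then show ?thesis using c[of "j div 2"] by (cases "j < 2 * n"; cases "even j") (simp_all add: ret_def)
    qed (simp add: ret_def)
    then show "continuous_on ?S ret" by (rule continuous_on_coordinatewise_then_product)
  next
    fix x assume "x \<in> topspace (top_of_set ?P)"
    then have x: "x \<in> ?P" by simp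
    have pos: "l2 (d x) > 0" using l2_pos l1_d[OF x] by simp
    show "ret (to x) = x"
    proof
      fix v
      show "ret (to x) v = x v"
      proof (cases v)
        case (Inl u) then show ?thesis using P(2)[OF x] by (simp add: ret_def)
      next
        case (Inr j)
        show ?thesis
        proof (cases "j < 2 * n")
          case False then show ?thesis using P(3)[OF x] Inr by (simp add: ret_def)
        next
          case True
          define i where "i = j div 2"
          have i: "i < n" "j = 2 * i \<or> j = 2 * i + 1" using True by (auto simp: i_def)
          have "ret (to x) v = max 0 (if even j then to x i else - to x i) * l2 (d x)"
            using True Inr l1_to[OF x] by (simp add: ret_def i_def)
          also have "\<dots> = max 0 (if even j then d x i else - d x i)"
            using i pos by (auto simp: to_def max_def zero_le_divide_iff field_simps)
          also have "\<dots> = x (Inr j)"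
            using i P(4)[OF x i(1)] P(1)[OF x, of "Inr (2 * i)"] P(1)[OF x, of "Inr (2 * i + 1)"]
            by (auto simp: d_def)
          finally show ?thesis using Inr by simp
        qed
      qed
    qed
  next
    fix z assume "z \<in> topspace (top_of_set ?S)"
    then have z: "z \<in> ?S" by simp
    have "l2 (d (ret z)) = sqrt (\<Sum>i<n. (z i)\<^sup>2 / (l1 z)\<^sup>2)"
      by (simp add: l2_def d_from power_divide)
    also have "\<dots> = 1 / l1 z"
      using z l1_pos[OF z] by (simp add: real_sqrt_divide flip: sum_divide_distrib)
    finally show "to (ret z) = z"
      using z l1_pos[OF z] by (auto simp: to_def d_from fun_eq_iff)
  qed (use to ret in auto)
  then show ?thesis
    by (intro homeomorphic_imp_homotopy_equivalent_space) (auto simp: homeomorphic_space_def)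
qed

text \<open>
  The reduced homology of a sphere determines its dimension.  The empty sphere is separate
  because \<open>nsphere 0\<close> consists of two points.
\<close>

lemma sphere_space_unique:
  assumes "sphere_space (int m - 1) homotopy_equivalent_space sphere_space (int n - 1)"
  shows "m = n"
proof -
  have empty: "topspace (sphere_space (int k - 1)) = {} \<longleftrightarrow> k = 0" for k
    by (simp add: sphere_space_def)
  have "m = 0 \<longleftrightarrow> n = 0"
    using homotopy_equivalent_empty_iff[OF assms] unfolding empty .
  moreover have "m = n" if "m \<noteq> 0" "n \<noteq> 0"
  proof -
    have s: "sphere_space (int k - 1) = nsphere (k - 1)" if "k \<noteq> 0" for k
      using that by (simp add: sphere_space_def nat_diff_distrib)
    have "reduced_homology_group (int (m - 1)) (nsphere (m - 1)) \<cong> reduced_homology_group (int (m - 1)) (nsphere (n - 1))"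
      using homotopy_equivalent_space_imp_isomorphic_reduced_homology_groups[OF assms] s that by simp
    then have "trivial_group (reduced_homology_group (int (m - 1)) (nsphere (m - 1))) \<longleftrightarrow>
      trivial_group (reduced_homology_group (int (m - 1)) (nsphere (n - 1)))"
      by (intro isomorphic_group_triviality) auto
    then show ?thesis using that by (auto simp: trivial_reduced_homology_group_nsphere)
  qed
  ultimately show ?thesis by blast
qed

lemma not_pointlike_sphere_space: "\<not> pointlike (sphere_space (int m - 1))"
  using non_contractible_space_nsphere by (auto simp: pointlike_def sphere_space_def)

section \<open>Stable homotopy types of graphs\<close>

text \<open>
  By \<open>susp_step\<close> a vertex can be traded for a disjoint edge.  The quantifier over the number of
  edges allows this step to be iterated.
\<close>

definition stably_contractible :: "('a \<Rightarrow> 'a \<Rightarrow> bool) \<Rightarrow> 'a set \<Rightarrow> bool" where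
  "stably_contractible adj V \<longleftrightarrow> (\<forall>k. pointlike (susp_space adj V k))"

text \<open>
  The parameter \<open>m\<close> is one more than the dimension of the sphere, so that the graph without
  vertices has \<open>m = 0\<close>.
\<close>

definition stably_sphere :: "('a \<Rightarrow> 'a \<Rightarrow> bool) \<Rightarrow> 'a set \<Rightarrow> nat \<Rightarrow> bool" where
  "stably_sphere adj V m \<longleftrightarrow>
    (\<forall>k. susp_space adj V k homotopy_equivalent_space sphere_space (int (m + k) - 1))"

lemma stably_sphere_unique:
  assumes "stably_sphere adj V m" "stably_sphere adj V n" shows "m = n"
proof -
  have "sphere_space (int (m + 0) - 1) homotopy_equivalent_space sphere_space (int (n + 0) - 1)"
    using assms unfolding stably_sphere_def by (meson homotopy_equivalent_space_sym homotopy_eqv_trans)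
  then show ?thesis using sphere_space_unique[of m n] by simp
qed

lemma stably_contractible_not_sphere: "stably_contractible adj V \<Longrightarrow> \<not> stably_sphere adj V m"
  unfolding stably_contractible_def stably_sphere_def
  using pointlike_homotopy_equivalent not_pointlike_sphere_space by blast

lemma stably_sphere_empty: "stably_sphere adj {} 0"
  by (simp add: stably_sphere_def cross_polytope_sphere)

lemma isolated_stably_contractible:
  assumes "simple_adj adj" "finite V" "v \<in> V" "\<And>u. u \<in> V \<Longrightarrow> \<not> adj v u"
  shows "stably_contractible adj V"
  using susp_isolated[OF assms] by (simp add: stably_contractible_def)

lemma contractible_link_delete:
  assumes "simple_adj adj" "finite V" "v \<in> V" "stably_contractible adj (non_nbrs adj V v)"
  shows "stably_contractible adj (V - {v}) \<Longrightarrow> stably_contractible adj V"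
    and "stably_sphere adj (V - {v}) m \<Longrightarrow> stably_sphere adj V m"
proof -
  have eq: "susp_space adj V k homotopy_equivalent_space susp_space adj (V - {v}) k" for k
    by (rule susp_delete) (use assms in \<open>auto simp: stably_contractible_def\<close>)
  show "stably_contractible adj (V - {v}) \<Longrightarrow> stably_contractible adj V"
    using pointlike_homotopy_equivalent[OF eq] by (simp add: stably_contractible_def)
  show "stably_sphere adj (V - {v}) m \<Longrightarrow> stably_sphere adj V m"
    unfolding stably_sphere_def by (blast intro: homotopy_eqv_trans[OF eq])
qed

lemma contractible_deletion_suspend:
  assumes "simple_adj adj" "finite V" "v \<in> V" "stably_contractible adj (V - {v})"
    and "stably_sphere adj (non_nbrs adj V v) m"
  shows "stably_sphere adj V (Suc m)"
proof -
  have eq: "susp_space adj V k homotopy_equivalent_space susp_space adj (non_nbrs adj V v) (Suc k)" for k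
    by (rule susp_step) (use assms in \<open>auto simp: stably_contractible_def\<close>)
  have "susp_space adj (non_nbrs adj V v) (Suc k) homotopy_equivalent_space sphere_space (int (Suc m + k) - 1)" for k
    using assms(5) unfolding stably_sphere_def by (metis add_Suc_shift)
  then show ?thesis
    unfolding stably_sphere_def by (blast intro: homotopy_eqv_trans[OF eq])
qed

text \<open>
  The graph with an additional leaf \<open>None\<close> attached to \<open>v\<close>.
\<close>

fun leaf_adj :: "('a \<Rightarrow> 'a \<Rightarrow> bool) \<Rightarrow> 'a \<Rightarrow> 'a option \<Rightarrow> 'a option \<Rightarrow> bool" where
  "leaf_adj adj v (Some x) (Some y) = adj x y"
| "leaf_adj adj v (Some x) None = (x = v)"
| "leaf_adj adj v None (Some y) = (y = v)"
| "leaf_adj adj v None None = False"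

lemma leaf_relabel:
  assumes "finite U"
  shows "susp_space adj U k homotopy_equivalent_space susp_space (leaf_adj adj v) (Some ` U) k"
proof -
  let ?f = "map_sum Some id :: 'a + nat \<Rightarrow> 'a option + nat"
  have "susp_space adj U k homotopy_equivalent_space ind_space (sum_adj (leaf_adj adj v)) (?f ` with_edges U k)"
    unfolding susp_space_def
  proof (rule ind_space_relabel)
    show "inj_on ?f (with_edges U k)" by (auto simp: inj_on_def with_edges_def)
    fix x y assume "x \<in> with_edges U k" "y \<in> with_edges U k"
    show "sum_adj (leaf_adj adj v) (?f x) (?f y) \<longleftrightarrow> sum_adj adj x y"
      by (cases x; cases y) auto
  qed (use assms in \<open>simp add: finite_with_edges\<close>)
  moreover have "?f ` with_edges U k = with_edges (Some ` U) k"
    by (auto simp: with_edges_def image_Un image_image)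
  ultimately show ?thesis by (simp add: susp_space_def)
qed

lemma non_nbrs_leaf:
  "non_nbrs (leaf_adj adj v) (insert None (Some ` V)) None = Some ` (V - {v})"
  "non_nbrs (leaf_adj adj v) (insert None (Some ` V)) (Some v) = Some ` non_nbrs adj V v"
proof -
  show "non_nbrs (leaf_adj adj v) (insert None (Some ` V)) None = Some ` (V - {v})"
  proof (rule Set.set_eqI)
    fix x show "x \<in> non_nbrs (leaf_adj adj v) (insert None (Some ` V)) None \<longleftrightarrow> x \<in> Some ` (V - {v})"
      by (cases x) (simp_all add: non_nbrs_def image_iff)
  qed
  show "non_nbrs (leaf_adj adj v) (insert None (Some ` V)) (Some v) = Some ` non_nbrs adj V v"
  proof (rule Set.set_eqI)
    fix x show "x \<in> non_nbrs (leaf_adj adj v) (insert None (Some ` V)) (Some v) \<longleftrightarrow> x \<in> Some ` non_nbrs adj V v"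
      by (cases x) (simp_all add: non_nbrs_def image_iff)
  qed
qed

text \<open>
  Let \<open>H\<close> be the graph with an additional leaf at \<open>v\<close>.  The deletion of the leaf is the given
  contractible complex, so \<open>H\<close> suspends \<open>Ind(V - v)\<close>; the deletion of \<open>v\<close> makes the leaf
  isolated, so \<open>H\<close> also suspends the link of \<open>v\<close>.
\<close>

lemma contractible_balance:
  assumes adj: "simple_adj adj" and V: "finite V" "v \<in> V" and contr: "stably_contractible adj V"
    and sph: "stably_sphere adj (V - {v}) a" "stably_sphere adj (non_nbrs adj V v) b"
  shows "a = b"
proof -
  let ?adj = "leaf_adj adj v" and ?V = "insert None (Some ` V)"
  have simple: "simple_adj ?adj"
    unfolding simple_adj_def
  proof (intro conjI allI impI)
    show "?adj y x" if "?adj x y" for x y using that adj by (cases x; cases y) (auto simp: simple_adj_def)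
    show "\<not> ?adj x x" for x using adj by (cases x) (auto simp: simple_adj_def)
  qed
  have fin: "finite ?V" using V by simp
  have sub: "finite (V - {v})" "finite (non_nbrs adj V v)" using V by (auto simp: non_nbrs_def)
  have "?V - {None} = Some ` V" by auto
  moreover have "non_nbrs ?adj ?V None = Some ` (V - {v})" by (rule non_nbrs_leaf)
  moreover have "pointlike (susp_space ?adj (Some ` V) 0)"
    using contr pointlike_homotopy_equivalent[OF leaf_relabel[OF V(1), of adj 0 v]]
    by (simp add: stably_contractible_def)
  ultimately have "susp_space ?adj ?V 0 homotopy_equivalent_space susp_space ?adj (Some ` (V - {v})) (Suc 0)"
    using susp_step[OF simple fin, of None 0] by simp
  moreover have "susp_space adj (V - {v}) (Suc 0) homotopy_equivalent_space susp_space ?adj (Some ` (V - {v})) (Suc 0)"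
    by (rule leaf_relabel[OF sub(1)])
  moreover have "susp_space adj (V - {v}) (Suc 0) homotopy_equivalent_space sphere_space (int (a + Suc 0) - 1)"
    using sph(1) unfolding stably_sphere_def by blast
  ultimately have A: "susp_space ?adj ?V 0 homotopy_equivalent_space sphere_space (int (a + Suc 0) - 1)"
    by (meson homotopy_equivalent_space_sym homotopy_eqv_trans)
  have "pointlike (susp_space ?adj (?V - {Some v}) 0)"
    by (rule susp_isolated[OF simple, of _ None]) (use fin in auto)
  moreover have "non_nbrs ?adj ?V (Some v) = Some ` non_nbrs adj V v" by (rule non_nbrs_leaf)
  ultimately have "susp_space ?adj ?V 0 homotopy_equivalent_space susp_space ?adj (Some ` non_nbrs adj V v) (Suc 0)"
    using susp_step[OF simple fin, of "Some v" 0] V by simp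
  moreover have "susp_space adj (non_nbrs adj V v) (Suc 0) homotopy_equivalent_space susp_space ?adj (Some ` non_nbrs adj V v) (Suc 0)"
    by (rule leaf_relabel[OF sub(2)])
  moreover have "susp_space adj (non_nbrs adj V v) (Suc 0) homotopy_equivalent_space sphere_space (int (b + Suc 0) - 1)"
    using sph(2) unfolding stably_sphere_def by blast
  ultimately have B: "susp_space ?adj ?V 0 homotopy_equivalent_space sphere_space (int (b + Suc 0) - 1)"
    by (meson homotopy_equivalent_space_sym homotopy_eqv_trans)
  have "sphere_space (int (a + Suc 0) - 1) homotopy_equivalent_space sphere_space (int (b + Suc 0) - 1)"
    using A B by (meson homotopy_equivalent_space_sym homotopy_eqv_trans)
  then show ?thesis using sphere_space_unique by fastforce
qed

lemma card_indep:
  assumes "simple_adj adj" "finite V" "v \<in> V"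
  shows "card (indep adj V) = card (indep adj (V - {v})) + card (indep adj (non_nbrs adj V v))"
proof -
  have fin: "finite (indep adj U)" if "finite U" for U
    by (rule finite_subset[of _ "Pow U"]) (use that in \<open>auto simp: indep_def\<close>)
  have eq: "indep adj V = indep adj (V - {v}) \<union> insert v ` indep adj (non_nbrs adj V v)"
  proof (intro Set.set_eqI iffI)
    fix S assume S: "S \<in> indep adj V"
    show "S \<in> indep adj (V - {v}) \<union> insert v ` indep adj (non_nbrs adj V v)"
    proof (cases "v \<in> S")
      case True
      then have "S - {v} \<in> indep adj (non_nbrs adj V v)" "S = insert v (S - {v})"
        using S by (auto simp: indep_def non_nbrs_def)
      then show ?thesis by blast
    qed (use S in \<open>auto simp: indep_def\<close>)
  next
    fix S assume "S \<in> indep adj (V - {v}) \<union> insert v ` indep adj (non_nbrs adj V v)"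
    then show "S \<in> indep adj V"
      using assms by (auto simp: indep_def non_nbrs_def simple_adj_def)
  qed
  have "inj_on (insert v) (indep adj (non_nbrs adj V v))"
    by (rule inj_onI) (auto simp: indep_def non_nbrs_def)
  then have "card (insert v ` indep adj (non_nbrs adj V v)) = card (indep adj (non_nbrs adj V v))"
    by (rule card_image)
  moreover have "finite (non_nbrs adj V v)" using assms by (simp add: non_nbrs_def)
  ultimately show ?thesis
    unfolding eq using assms by (subst card_Un_disjoint) (auto simp: fin, auto simp: indep_def)
qed



section \<open>Critical graphs\<close>

text \<open>
  The possible levels of a pattern \<open>r\<close> whose two refinements by one more vertex have the levels
  \<open>p\<close> (vertex out) and \<open>q\<close> (vertex in).
\<close>

definition splits :: "nat option \<Rightarrow> nat option \<Rightarrow> nat option \<Rightarrow> bool" where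
  "splits p q r \<longleftrightarrow>
    p = None \<and> r = q \<or> q = None \<and> r = p \<or> (\<exists>k. p = Some k \<and> q = Some (Suc k) \<and> r = None)"

text \<open>
  A pattern \<open>X\<close>, \<open>Y\<close> forces \<open>X\<close> out of and \<open>Y\<close> into an independent set, and \<open>lev X Y\<close> records the
  dimension of the complex of the choices that remain.  The rule \<open>lev_split\<close> does not cover the
  empty pattern: this is where a critical graph differs from its proper induced subgraphs.
\<close>

locale critical =
  fixes V :: "'a set" and adj :: "'a \<Rightarrow> 'a \<Rightarrow> bool"
    and lev :: "'a set \<Rightarrow> 'a set \<Rightarrow> nat option"
  assumes finite_V: "finite V" and nonempty: "V \<noteq> {}"
    and adj_sym: "adj u v \<Longrightarrow> adj v u" and adj_irrefl: "\<not> adj v v"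
    and has_neighbour: "v \<in> V \<Longrightarrow> \<exists>u\<in>V. adj v u"
    and lev_split: "\<lbrakk>X \<subseteq> V; Y \<subseteq> V; X \<inter> Y = {}; X \<union> Y \<noteq> {}; w \<in> V; w \<notin> X; w \<notin> Y\<rbrakk>
      \<Longrightarrow> splits (lev (insert w X) Y) (lev X (insert w Y)) (lev X Y)"
    and lev_edge: "\<lbrakk>u \<in> Y; v \<in> Y; adj u v\<rbrakk> \<Longrightarrow> lev X Y = None"
    and lev_isolated: "\<lbrakk>X \<subseteq> V; Y \<subseteq> V; X \<inter> Y = {}; X \<union> Y \<noteq> {}; v \<in> V; v \<notin> X; v \<notin> Y;
        \<And>u. u \<in> V \<Longrightarrow> adj v u \<Longrightarrow> u \<in> X\<rbrakk> \<Longrightarrow> lev X Y = None"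
    and lev_out: "v \<in> V \<Longrightarrow> lev {v} {} \<noteq> None" and lev_in: "v \<in> V \<Longrightarrow> lev {} {v} \<noteq> None"
begin

text \<open>
  A pair of vertices has four patterns, of which exactly two are defined: out-out and in-in for
  twins, out-in and in-out otherwise (\<open>pair_levels\<close>).
\<close>

definition twin :: "'a \<Rightarrow> 'a \<Rightarrow> bool" where
  "twin u v \<longleftrightarrow> u = v \<or> lev {u, v} {} \<noteq> None"

lemma twin_sym: "twin u v \<longleftrightarrow> twin v u"
  by (auto simp: twin_def insert_commute)

lemma pair_levels:
  assumes "u \<in> V" "v \<in> V" "u \<noteq> v"
  shows "if twin u v
    then lev {u, v} {} = lev {u} {} \<and> lev {v} {} = lev {u} {} \<and> lev {v} {u} = None
      \<and> lev {u} {v} = None \<and> lev {} {u, v} = lev {} {u} \<and> lev {} {v} = lev {} {u}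
    else lev {u, v} {} = None \<and> lev {} {u, v} = None \<and> lev {u} {v} = lev {u} {}
      \<and> lev {v} {u} = lev {v} {} \<and> lev {u} {v} = lev {} {v} \<and> lev {v} {u} = lev {} {u}"
proof -
  have "splits (lev {v, u} {}) (lev {u} {v}) (lev {u} {})"
    "splits (lev {v, u} {}) (lev {v} {u}) (lev {v} {})"
    "splits (lev {v} {u}) (lev {} {v, u}) (lev {} {u})"
    "splits (lev {u} {v}) (lev {} {v, u}) (lev {} {v})"
    using lev_split[of "{u}" "{}" v] lev_split[of "{v}" "{}" u] lev_split[of "{}" "{u}" v]
      lev_split[of "{}" "{v}" u] assms by (simp_all add: insert_commute)
  then show ?thesis
    using lev_out[of u] lev_out[of v] lev_in[of u] lev_in[of v] assms
    by (auto simp: splits_def twin_def insert_commute)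
qed

lemma adj_not_twin:
  assumes "u \<in> V" "v \<in> V" "adj u v" shows "\<not> twin u v"
proof -
  have "u \<noteq> v" using assms(3) adj_irrefl by blast
  then show ?thesis
    using pair_levels[of u v] lev_edge[of u "{u, v}" v "{}"] lev_in[of u] assms by (metis insertCI)
qed

text \<open>
  Twins of \<open>v\<close> move together: among the patterns on \<open>v\<close> and a set \<open>S\<close> of its twins only the two
  constant ones are defined.  When a further twin \<open>w\<close> is added, the values on smaller sets leave
  one bit open for the patterns with \<open>v\<close> out and one for those with \<open>v\<close> in.  A wrong choice makes
  mixed patterns defined, whose level grows by one with each vertex that is moved in.  At the far
  end the level is off by the number of vertices moved, and because of \<open>b \<le> a\<close> it clashes there
  with a known value.
\<close>

lemma twin_cube:
  assumes v: "v \<in> V" and a: "lev {v} {} = Some a" and b: "lev {} {v} = Some b" and le: "b \<le> a"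
    and "S \<subseteq> V" "v \<notin> S" "\<And>s. s \<in> S \<Longrightarrow> twin v s" "T \<subseteq> S"
  shows "lev (insert v (S - T)) T = (if T = {} then Some a else None) \<and>
     lev (S - T) (insert v T) = (if T = S then Some b else None)"
  using assms(5-8)
proof (induction "card S" arbitrary: S T rule: less_induct)
  case less
  have "finite S" using less.prems(1) finite_V finite_subset by blast
  show ?case
  proof (cases "S = {}")
    case True then show ?thesis using less.prems a b by auto
  next
    case False
    then obtain w where w: "w \<in> S" by blast
    define S0 where "S0 = S - {w}"
    have S: "S = insert w S0" "w \<notin> S0" using w by (auto simp: S0_def)
    have finS0: "finite S0" and cS0: "card S0 < card S" using S \<open>finite S\<close> by auto
    have wV: "w \<in> V" "w \<noteq> v" "v \<notin> S0" "S0 \<subseteq> V" using less.prems S by auto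
    show ?thesis
    proof (cases "S0 = {}")
      case True
      then have "S = {w}" using S by simp
      then show ?thesis using pair_levels[of v w] v wV less.prems a b
        by (cases "T = {}") (auto simp: insert_commute subset_singleton_iff)
    next
      case ne: False
      have IH0: "lev (insert v (S0 - T)) T = (if T = {} then Some a else None)"
        "lev (S0 - T) (insert v T) = (if T = S0 then Some b else None)" if "T \<subseteq> S0" for T
        using less.hyps[OF cS0, of T] less.prems S that by auto
      have IHs: "lev (insert v (insert w (S0 - {s}) - T)) T = (if T = {} then Some a else None)"
        "lev (insert w (S0 - {s}) - T) (insert v T) = (if T = insert w (S0 - {s}) then Some b else None)"
        if "s \<in> S0" "T \<subseteq> insert w (S0 - {s})" for s T
      proof -
        have "card (insert w (S0 - {s})) < card S"
          using S finS0 that by (simp add: card_gt_0_iff) (metis card_gt_0_iff empty_iff le_SucI less_Suc_eq_le diff_Suc_less)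
        moreover have "insert w (S0 - {s}) \<subseteq> V" "v \<notin> insert w (S0 - {s})"
          "\<And>x. x \<in> insert w (S0 - {s}) \<Longrightarrow> twin v x"
          using less.prems S by auto
        ultimately have C: "lev (insert v (insert w (S0 - {s}) - T)) T = (if T = {} then Some a else None) \<and>
          lev (insert w (S0 - {s}) - T) (insert v T) = (if T = insert w (S0 - {s}) then Some b else None)"
          using that(2) by (rule less.hyps)
        show "lev (insert v (insert w (S0 - {s}) - T)) T = (if T = {} then Some a else None)"
          by (rule C[THEN conjunct1])
        show "lev (insert w (S0 - {s}) - T) (insert v T) = (if T = insert w (S0 - {s}) then Some b else None)"
          by (rule C[THEN conjunct2])
      qed
      \<comment> \<open>\<open>A\<close> and \<open>B\<close>: \<open>v\<close> out and in; \<open>D\<close>: \<open>v\<close> unspecified; the index tells whether \<open>w\<close> is in;\<close>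
      \<comment> \<open>\<open>T\<close> is the part of \<open>S0\<close> that is in.\<close>
      define A0 where "A0 T = lev (insert w (insert v (S0 - T))) T" for T
      define A1 where "A1 T = lev (insert v (S0 - T)) (insert w T)" for T
      define B0 where "B0 T = lev (insert w (S0 - T)) (insert v T)" for T
      define B1 where "B1 T = lev (S0 - T) (insert w (insert v T))" for T
      define D0 where "D0 T = lev (insert w (S0 - T)) T" for T
      define D1 where "D1 T = lev (S0 - T) (insert w T)" for T
      have wA: "splits (A0 T) (A1 T) (if T = {} then Some a else None)"
        and wB: "splits (B0 T) (B1 T) (if T = S0 then Some b else None)"
        and vA: "splits (A0 T) (B0 T) (D0 T)" and vB: "splits (A1 T) (B1 T) (D1 T)"
        and wD: "splits (D0 T) (D1 T) (lev (S0 - T) T)"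
        and vD: "splits (if T = {} then Some a else None) (if T = S0 then Some b else None) (lev (S0 - T) T)"
        if T: "T \<subseteq> S0" for T
      proof -
        have "splits (A0 T) (A1 T) (lev (insert v (S0 - T)) T)"
          unfolding A0_def A1_def using T wV S v by (intro lev_split) auto
        then show "splits (A0 T) (A1 T) (if T = {} then Some a else None)"
          unfolding IH0(1)[OF T] .
        have "splits (B0 T) (B1 T) (lev (S0 - T) (insert v T))"
          unfolding B0_def B1_def using T wV S v by (intro lev_split) auto
        then show "splits (B0 T) (B1 T) (if T = S0 then Some b else None)"
          unfolding IH0(2)[OF T] .
        show "splits (A0 T) (B0 T) (D0 T)"
          unfolding A0_def B0_def D0_def insert_commute[of w v] using T wV S v by (intro lev_split) auto
        show "splits (A1 T) (B1 T) (D1 T)"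
          unfolding A1_def B1_def D1_def insert_commute[of w v] using T wV S v by (intro lev_split) auto
        have ne': "(S0 - T) \<union> T \<noteq> {}" using ne by auto
        show "splits (D0 T) (D1 T) (lev (S0 - T) T)"
          unfolding D0_def D1_def using ne' T wV S v by (intro lev_split) auto
        have "splits (lev (insert v (S0 - T)) T) (lev (S0 - T) (insert v T)) (lev (S0 - T) T)"
          using ne' T wV S v by (intro lev_split) auto
        then show "splits (if T = {} then Some a else None) (if T = S0 then Some b else None) (lev (S0 - T) T)"
          unfolding IH0[OF T] .
      qed
      have sA1: "splits (A1 T) (A1 (insert s T)) None"
        and sB0: "splits (B0 T) (B0 (insert s T)) None"
        if s: "s \<in> S0" "s \<notin> T" "T \<subseteq> S0" for s T
      proof -
        have eq: "insert w (S0 - {s}) - insert w T = S0 - insert s T"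
          "insert w (S0 - {s}) - T = insert w (S0 - insert s T)"
          "insert s (insert v (S0 - insert s T)) = insert v (S0 - T)"
          "insert s (insert w (S0 - insert s T)) = insert w (S0 - T)"
          "insert s (insert w T) = insert w (insert s T)" "insert s (insert v T) = insert v (insert s T)"
          using s S by auto
        have "insert w T \<subseteq> insert w (S0 - {s})" using s by auto
        from IHs(1)[OF s(1) this] have "lev (insert v (S0 - insert s T)) (insert w T) = None"
          unfolding eq by simp
        moreover have "splits (lev (insert s (insert v (S0 - insert s T))) (insert w T))
          (lev (insert v (S0 - insert s T)) (insert s (insert w T))) (lev (insert v (S0 - insert s T)) (insert w T))"
          using s wV S v by (intro lev_split) auto
        ultimately show "splits (A1 T) (A1 (insert s T)) None"
          unfolding A1_def eq by simp
        have "T \<subseteq> insert w (S0 - {s})" "T \<noteq> insert w (S0 - {s})" using s S by auto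
        with IHs(2)[OF s(1), of T] have "lev (insert w (S0 - insert s T)) (insert v T) = None"
          unfolding eq(2) by simp
        moreover have "splits (lev (insert s (insert w (S0 - insert s T))) (insert v T))
          (lev (insert w (S0 - insert s T)) (insert s (insert v T))) (lev (insert w (S0 - insert s T)) (insert v T))"
          using s wV S v by (intro lev_split) auto
        ultimately show "splits (B0 T) (B0 (insert s T)) None"
          unfolding B0_def eq by simp
      qed
      have pos: "card S0 > 0" using ne finS0 by (simp add: card_gt_0_iff)
      have A0: "A0 {} = Some a \<and> A1 {} = None"
      proof (rule ccontr)
        assume "\<not> ?thesis"
        then have start: "A1 {} = Some a" using wA[of "{}"] by (auto simp: splits_def)
        \<comment> \<open>moving the members of \<open>S0\<close> in one by one raises the level from \<open>a\<close> to \<open>a + card S0\<close>\<close>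
        have "A1 T = Some (a + card T)" if "T \<subseteq> S0" for T
          using finite_subset[OF that finS0] that
        proof (induction T)
          case (insert s T) then show ?case using sA1[of s T] by (auto simp: splits_def)
        qed (simp add: start)
        from this[of S0] show False
          using wA[of S0] wB[of S0] vA[of S0] vB[of S0] wD[of S0] vD[of S0] ne pos le
          by (auto simp: splits_def)
      qed
      have A1: "A1 T = None" if "T \<subseteq> S0" for T
        using finite_subset[OF that finS0] that
      proof (induction T)
        case (insert s T) then show ?case using sA1[of s T] by (auto simp: splits_def)
      qed (simp add: A0)
      have A0': "A0 T = (if T = {} then Some a else None)" if "T \<subseteq> S0" for T
        using wA[OF that] A1[OF that] by (cases "T = {}") (auto simp: splits_def)
      have B1: "B1 S0 = Some b \<and> B0 S0 = None"
      proof (rule ccontr)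
        assume "\<not> ?thesis"
        then have start: "B0 S0 = Some b" using wB[of S0] by (auto simp: splits_def)
        \<comment> \<open>moving the members of \<open>S0\<close> out one by one lowers the level from \<open>b\<close> to \<open>b - card S0\<close>\<close>
        have "\<exists>k. B0 (S0 - U) = Some k \<and> k + card U = b" if "U \<subseteq> S0" for U
          using finite_subset[OF that finS0] that
        proof (induction U)
          case (insert s U)
          have "insert s (S0 - insert s U) = S0 - U" using insert by auto
          then show ?case using sB0[of s "S0 - insert s U"] insert by (auto simp: splits_def)
        qed (simp add: start)
        from this[of S0] show False using vA[of "{}"] A0 le by (auto simp: splits_def)
      qed
      have B0: "B0 (S0 - U) = None" if "U \<subseteq> S0" for U
        using finite_subset[OF that finS0] that
      proof (induction U)
        case (insert s U)
        have "insert s (S0 - insert s U) = S0 - U" using insert by auto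
        then show ?case using sB0[of s "S0 - insert s U"] insert by (auto simp: splits_def)
      qed (simp add: B1)
      have B0': "B0 T = None" if "T \<subseteq> S0" for T
        using B0[of "S0 - T"] that by (simp add: double_diff)
      have B1': "B1 T = (if T = S0 then Some b else None)" if "T \<subseteq> S0" for T
        using wB[OF that] B0'[OF that] by (cases "T = S0") (auto simp: splits_def)
      show ?thesis
      proof (cases "w \<in> T")
        case True
        define T' where "T' = T - {w}"
        have T': "T = insert w T'" "T' \<subseteq> S0" "w \<notin> T'" using True less.prems S by (auto simp: T'_def)
        have "S - T = S0 - T'" using T' S by auto
        then show ?thesis using A1[OF T'(2)] B1'[OF T'(2)] T' S
          unfolding A1_def B1_def by (auto simp: insert_commute)
      next
        case False
        then have T': "T \<subseteq> S0" "S - T = insert w (S0 - T)" "T \<noteq> S" using less.prems S by auto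
        then show ?thesis using A0'[OF T'(1)] B0'[OF T'(1)] S
          unfolding A0_def B0_def by (auto simp: insert_commute)
      qed
    qed
  qed
qed

text \<open>
  Otherwise \<open>v\<close> and all neighbours of \<open>u\<close> could be forced out with a defined level, although
  this isolates \<open>u\<close>.
\<close>

lemma neighbour_not_twin:
  assumes "v \<in> V" "lev {v} {} = Some a" "lev {} {v} = Some b" "b \<le> a" "u \<in> V" "adj v u"
  shows "\<exists>w\<in>V. adj u w \<and> \<not> twin v w"
proof (rule ccontr)
  assume "\<not> ?thesis"
  then have tw: "twin v w" if "w \<in> V" "adj u w" for w using that by blast
  define S where "S = {w \<in> V. adj u w} - {v}"
  have "lev (insert v (S - {})) {} = Some a"
    using twin_cube[of v a b S "{}"] assms tw by (auto simp: S_def)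
  moreover have "lev (insert v S) {} = None"
    by (rule lev_isolated[of _ _ u]) (use assms adj_irrefl in \<open>auto simp: S_def\<close>)
  ultimately show False by simp
qed

text \<open>
  Non-twins exchange their two levels.  If the levels of \<open>v\<close> differed, this would leave just two
  kinds of vertices, non-twins being of different kinds.  But a neighbour of \<open>v\<close> has a neighbour
  that is no twin of \<open>v\<close>, and these three vertices are pairwise non-twins.
\<close>

lemma balanced:
  assumes "v \<in> V" shows "lev {} {v} = lev {v} {}"
proof -
  have no_gt: False if v: "v \<in> V" and ab: "lev {v} {} = Some a" "lev {} {v} = Some b" "b < a" for v a b
  proof -
    obtain u where u: "u \<in> V" "adj v u" using has_neighbour[OF v] by blast
    then obtain w where w: "w \<in> V" "adj u w" "\<not> twin v w"
      using neighbour_not_twin[OF v ab(1,2) _ u] ab(3) by auto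
    have "\<not> twin v u" "\<not> twin u w" using adj_not_twin u w v by auto
    moreover have "v \<noteq> u" "v \<noteq> w" "u \<noteq> w" using u w adj_irrefl by (auto simp: twin_def)
    ultimately show False
      using pair_levels[of v u] pair_levels[of u w] pair_levels[of v w] u w v ab by auto
  qed
  obtain a b where ab: "lev {v} {} = Some a" "lev {} {v} = Some b"
    using lev_out lev_in assms by blast
  obtain u where u: "u \<in> V" "adj v u" using has_neighbour assms by blast
  then have "\<not> twin v u" "v \<noteq> u" using adj_not_twin adj_irrefl assms by auto
  then have "lev {u} {} = Some b" "lev {} {u} = Some a" using pair_levels[of v u] ab u assms by auto
  then show ?thesis using no_gt[of v a b] no_gt[of u b a] ab u assms by force
qed

lemma common_level: "\<exists>d. \<forall>v\<in>V. lev {v} {} = Some d \<and> lev {} {v} = Some d"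
proof -
  obtain v where v: "v \<in> V" using nonempty by blast
  then obtain d where d: "lev {v} {} = Some d" using lev_out by blast
  have "lev {u} {} = Some d" if "u \<in> V" for u
    using pair_levels[of v u] balanced[of u] balanced[of v] that v d by (cases "u = v") (auto split: if_splits)
  then show ?thesis using balanced by auto
qed

lemma third_class:
  assumes "u \<in> V" "v \<in> V" "adj v u"
  shows "\<exists>w\<in>V. adj u w \<and> \<not> twin v w"
  using common_level neighbour_not_twin[OF assms(2) _ _ order_refl assms(1,3)] assms(2) by blast

lemma twin_trans:
  assumes "u \<in> V" "v \<in> V" "w \<in> V" "twin u v" "twin v w" shows "twin u w"
proof (cases "u = v \<or> v = w \<or> u = w")
  case True then show ?thesis using assms by (auto simp: twin_def)
next
  case False
  obtain d where d: "\<And>v. v \<in> V \<Longrightarrow> lev {v} {} = Some d" "\<And>v. v \<in> V \<Longrightarrow> lev {} {v} = Some d"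
    using common_level by blast
  have cube: "lev (insert v ({u, w} - {})) {} = Some d" "lev ({u, w} - {}) (insert v {}) = None"
    using twin_cube[of v d d "{u, w}" "{}"] assms False d twin_sym[of u v] by auto
  have "splits (lev (insert v {u, w}) {}) (lev {u, w} {v}) (lev {u, w} {})"
    using lev_split[of "{u, w}" "{}" v] assms False by auto
  then show ?thesis using cube by (auto simp: twin_def splits_def)
qed

text \<open>
  Suppose not; then no two of the four vertices are twins.  For an edge and a third vertex that is
  no twin of its ends, the pattern with all three out has level \<open>d - 1\<close>, and the one with just the
  third vertex in has level \<open>d\<close> (\<open>single\<close>).  Because of the edge \<open>wx\<close>, the pattern with \<open>x\<close> in
  and \<open>u\<close>, \<open>v\<close> out can only be refined by keeping \<open>w\<close> out, and passes its level \<open>d\<close> on.  But the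
  result also refines the pattern with \<open>u\<close>, \<open>v\<close>, \<open>w\<close> out, of level \<open>d - 1\<close>, by moving \<open>x\<close> in,
  and \<open>lev_split\<close> does not allow this.
\<close>

lemma path_returns:
  assumes V: "u \<in> V" "v \<in> V" "w \<in> V" "x \<in> V" and adj: "adj u v" "adj v w" "adj w x"
    and nt: "\<not> twin u w" "\<not> twin v x"
  shows "twin u x"
proof (rule ccontr)
  assume nt3: "\<not> twin u x"
  obtain d where d: "\<And>v. v \<in> V \<Longrightarrow> lev {v} {} = Some d" "\<And>v. v \<in> V \<Longrightarrow> lev {} {v} = Some d"
    using common_level by blast
  have nt': "\<not> twin u v" "\<not> twin v w" "\<not> twin w x" using adj_not_twin V adj by auto
  have dist: "u \<noteq> v" "u \<noteq> w" "u \<noteq> x" "v \<noteq> w" "v \<noteq> x" "w \<noteq> x"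
    using nt nt' nt3 by (auto simp: twin_def)
  have single: "lev {p, q} {r} = Some d \<and> (\<exists>e. lev {p, q, r} {} = Some e \<and> Suc e = d)"
    if "p \<in> V" "q \<in> V" "r \<in> V" "p \<noteq> q" "p \<noteq> r" "q \<noteq> r" "adj p q" "\<not> twin p q" "\<not> twin p r" "\<not> twin q r"
    for p q r
  proof -
    have "lev {} {p, q, r} = None" by (rule lev_edge[of p _ q]) (use that in auto)
    moreover have "splits (lev {q} {p, r}) (lev {} {p, q, r}) (lev {} {p, r})"
      using lev_split[of "{}" "{p, r}" q] that by (auto simp: insert_commute)
    moreover have "splits (lev {p} {q, r}) (lev {} {p, q, r}) (lev {} {q, r})"
      using lev_split[of "{}" "{q, r}" p] that by (auto simp: insert_commute)
    moreover have "splits (lev {p, q} {r}) (lev {p} {q, r}) (lev {p} {r})"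
      using lev_split[of "{p}" "{r}" q] that by (auto simp: insert_commute)
    moreover have "splits (lev {p, q, r} {}) (lev {p, q} {r}) (lev {p, q} {})"
      using lev_split[of "{p, q}" "{}" r] that by (auto simp: insert_commute)
    ultimately show ?thesis
      using pair_levels[of p r] pair_levels[of q r] pair_levels[of p q] that d by (auto simp: splits_def)
  qed
  have "lev {u, v} {w, x} = None" by (rule lev_edge[of w _ x]) (use adj in auto)
  moreover have "splits (lev {u, v, w} {x}) (lev {u, v} {w, x}) (lev {u, v} {x})"
    using lev_split[of "{u, v}" "{x}" w] V dist by (auto simp: insert_commute)
  moreover have "lev {u, v} {x} = Some d" using single[of u v x] V dist adj nt nt' nt3 by auto
  ultimately have "lev {u, v, w} {x} = Some d" by (auto simp: splits_def)
  moreover have "splits (lev {u, v, w, x} {}) (lev {u, v, w} {x}) (lev {u, v, w} {})"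
    using lev_split[of "{u, v, w}" "{}" x] V dist by (auto simp: insert_commute)
  moreover have "\<exists>e. lev {u, v, w} {} = Some e \<and> Suc e = d" using single[of u v w] V dist adj nt nt' by auto
  ultimately show False by (auto simp: splits_def)
qed

text \<open>
  Each step leaves the classes of the last two vertices, which is possible by \<open>third_class\<close>; the
  class of the vertex three steps back is then forced by \<open>path_returns\<close>.
\<close>

lemma class_three_walk:
  obtains f :: "nat \<Rightarrow> 'a" where "\<And>i. f i \<in> V" "\<And>i. adj (f i) (f (Suc i))"
    "\<And>i j. twin (f i) (f j) \<longleftrightarrow> i mod 3 = j mod 3"
proof -
  obtain v0 where "v0 \<in> V" using nonempty by blast
  then obtain v1 where "v1 \<in> V" "adj v0 v1" using has_neighbour by blast
  define P where "P = (\<lambda>p :: 'a \<times> 'a. fst p \<in> V \<and> snd p \<in> V \<and> adj (fst p) (snd p))"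
  have "\<exists>g. \<forall>i. P (g i) \<and> (fst (g (Suc i)) = snd (g i) \<and> \<not> twin (fst (g i)) (snd (g (Suc i))))"
  proof (rule dependent_nat_choice)
    show "\<exists>p. P p" using \<open>v0 \<in> V\<close> \<open>v1 \<in> V\<close> \<open>adj v0 v1\<close> by (intro exI[of _ "(v0, v1)"]) (auto simp: P_def)
    fix p assume "P p"
    then obtain w where "w \<in> V" "adj (snd p) w" "\<not> twin (fst p) w"
      using third_class[of "snd p" "fst p"] by (auto simp: P_def)
    then show "\<exists>q. P q \<and> fst q = snd p \<and> \<not> twin (fst p) (snd q)"
      using \<open>P p\<close> by (intro exI[of _ "(snd p, w)"]) (auto simp: P_def)
  qed
  then obtain g where g: "\<And>i. P (g i)" "\<And>i. fst (g (Suc i)) = snd (g i)"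
    "\<And>i. \<not> twin (fst (g i)) (snd (g (Suc i)))" by blast
  define f where "f i = fst (g i)" for i
  have fV: "f i \<in> V" for i using g(1) by (auto simp: P_def f_def)
  have fadj: "adj (f i) (f (Suc i))" for i using g(1)[of i] g(2)[of i] by (auto simp: P_def f_def)
  have f2: "\<not> twin (f i) (f (Suc (Suc i)))" for i using g(2)[of "Suc i"] g(3)[of i] by (auto simp: f_def)
  have f1: "\<not> twin (f i) (f (Suc i))" for i using adj_not_twin fV fadj by blast
  have f3: "twin (f i) (f (i + 3))" for i
    using path_returns[OF fV fV fV fV fadj fadj fadj f2 f2, of i] by (simp add: numeral_3_eq_3)
  have per: "twin (f i) (f (i + 3 * k))" for i k
  proof (induction k)
    case (Suc k)
    have "twin (f (i + 3 * k)) (f (i + 3 * Suc k))" using f3[of "i + 3 * k"] by (simp add: algebra_simps)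
    then show ?case using Suc twin_trans fV by blast
  qed (simp add: twin_def)
  have red: "twin (f (i mod 3)) (f i)" for i
    using per[of "i mod 3" "i div 3"] by simp
  have small: "twin (f i) (f j) \<longleftrightarrow> i = j" if "i < 3" "j < 3" for i j
  proof -
    have "\<not> twin (f 0) (f 1)" "\<not> twin (f 1) (f 2)" "\<not> twin (f 0) (f 2)" "twin (f i) (f i)"
      using f1[of 0] f1[of 1] f2[of 0] by (simp_all add: numeral_2_eq_2 twin_def)
    moreover have "i = 0 \<or> i = 1 \<or> i = 2" "j = 0 \<or> j = 1 \<or> j = 2" using that by auto
    moreover have "\<not> twin (f 1) (f 0)" "\<not> twin (f 2) (f 1)" "\<not> twin (f 2) (f 0)"
      using calculation twin_sym by blast+
    ultimately show ?thesis by (elim disjE) (simp_all add: twin_def)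
  qed
  have "twin (f i) (f j) \<longleftrightarrow> i mod 3 = j mod 3" for i j
  proof -
    have red': "twin (f i) (f (i mod 3))" for i using red[of i] twin_sym[of "f i" "f (i mod 3)"] by simp
    have "twin (f i) (f j) \<longleftrightarrow> twin (f (i mod 3)) (f (j mod 3))"
    proof
      assume "twin (f i) (f j)"
      then have "twin (f i) (f (j mod 3))" using red'[of j] by (rule twin_trans[OF fV fV fV])
      with red[of i] show "twin (f (i mod 3)) (f (j mod 3))" by (rule twin_trans[OF fV fV fV])
    next
      assume "twin (f (i mod 3)) (f (j mod 3))"
      then have "twin (f (i mod 3)) (f j)" using red[of j] by (rule twin_trans[OF fV fV fV])
      with red'[of i] show "twin (f i) (f j)" by (rule twin_trans[OF fV fV fV])
    qed
    then show ?thesis using small by simp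
  qed
  then show ?thesis using that fV fadj by blast
qed

lemma cycle_mod_3:
  obtains xs where "distinct xs" "set xs \<subseteq> V" "3 \<le> length xs" "3 dvd length xs"
    "successively adj xs" "adj (last xs) (hd xs)"
proof -
  obtain f where f: "\<And>i :: nat. f i \<in> V" "\<And>i. adj (f i) (f (Suc i))"
    "\<And>i j. twin (f i) (f j) \<longleftrightarrow> i mod 3 = j mod 3" using class_three_walk by blast
  have "\<not> inj f" using f(1) finite_V by (metis finite_imageD finite_subset image_subsetI infinite_UNIV_nat)
  then have "\<exists>j. \<exists>i<j. f i = f j" by (metis injI linorder_neqE_nat)
  define j where "j = (LEAST j. \<exists>i<j. f i = f j)"
  have "\<exists>i<j. f i = f j" unfolding j_def by (rule LeastI_ex) fact
  then obtain i where i: "i < j" "f i = f j" by blast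
  have inj: "inj_on f {..<j}"
  proof (rule linorder_inj_onI)
    fix x y assume "x < y" "x \<in> {..<j}" "y \<in> {..<j}"
    then show "f x \<noteq> f y" using not_less_Least[of y "\<lambda>j. \<exists>i<j. f i = f j"] by (auto simp: j_def)
  qed auto
  have "i mod 3 = j mod 3" using f(3)[of i j] i by (simp add: twin_def)
  then have dvd: "3 dvd j - i" using i by (metis mod_eq_dvd_iff_nat less_imp_le)
  let ?xs = "map f [i..<j]"
  show ?thesis
  proof (rule that[of ?xs])
    show "distinct ?xs" using inj by (auto simp: distinct_map intro: inj_on_subset)
    show "set ?xs \<subseteq> V" using f(1) by auto
    show "3 dvd length ?xs" using dvd by simp
    show "3 \<le> length ?xs" using dvd i by (auto dest: dvd_imp_le)
    show "successively adj ?xs" using f(2) by (auto simp: successively_conv_nth)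
    have "f (Suc (j - 1)) = f i" using i by simp
    then show "adj (last ?xs) (hd ?xs)" using f(2)[of "j - 1"] i by (simp add: last_map hd_map)
  qed
qed

end

section \<open>The classification\<close>

text \<open>
  The parity of the number of independent sets is the Euler characteristic modulo two.  It is
  carried along because it excludes that link, deletion and complex are all spheres.
\<close>

definition classified :: "('a \<Rightarrow> 'a \<Rightarrow> bool) \<Rightarrow> 'a set \<Rightarrow> bool" where
  "classified adj V \<longleftrightarrow> stably_contractible adj V \<and> even (card (indep adj V))
    \<or> (\<exists>m. stably_sphere adj V m) \<and> odd (card (indep adj V))"

definition level :: "('a \<Rightarrow> 'a \<Rightarrow> bool) \<Rightarrow> 'a set \<Rightarrow> nat option" where
  "level adj V = (if \<exists>m. stably_sphere adj V m then Some (THE m. stably_sphere adj V m) else None)"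

lemma level_eq: "level adj V = Some m \<longleftrightarrow> stably_sphere adj V m"
proof -
  have "(THE m. stably_sphere adj V m) = k" if "stably_sphere adj V k" for k
    using that stably_sphere_unique by (blast intro: the_equality)
  then show ?thesis unfolding level_def by auto
qed

lemma level_None: "stably_contractible adj V \<Longrightarrow> level adj V = None"
  unfolding level_def using stably_contractible_not_sphere by metis

lemma level_odd: "classified adj V \<Longrightarrow> level adj V = None \<longleftrightarrow> even (card (indep adj V))"
  by (auto simp: classified_def simp flip: level_eq dest: level_None)

lemma classified_cases:
  assumes "classified adj V"
  obtains "stably_contractible adj V" "level adj V = None" "even (card (indep adj V))"
  | m where "stably_sphere adj V m" "level adj V = Some m" "odd (card (indep adj V))"
  using assms unfolding classified_def
proof (elim disjE conjE exE)
  assume "stably_contractible adj V" "even (card (indep adj V))"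
  then show thesis by (intro that(1) level_None)
next
  fix m assume "stably_sphere adj V m" "odd (card (indep adj V))"
  then show thesis by (intro that(2)[of m]) (simp_all add: level_eq)
qed

lemma classified_step:
  assumes "simple_adj adj" "finite V" "v \<in> V"
    and "classified adj (V - {v})" "classified adj (non_nbrs adj V v)"
    and "even (card (indep adj (V - {v}))) \<or> even (card (indep adj (non_nbrs adj V v)))"
  shows "classified adj V"
  using assms(5)
proof (cases rule: classified_cases)
  case 1
  then show ?thesis
    using assms(4) contractible_link_delete[OF assms(1-3)] card_indep[OF assms(1-3)]
    unfolding classified_def by auto
next
  case (2 m)
  then have "even (card (indep adj (V - {v})))" using assms(6) by simp
  moreover from this have "stably_contractible adj (V - {v})" using assms(4) by (auto simp: classified_def)
  ultimately show ?thesis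
    using contractible_deletion_suspend[OF assms(1-3) _ 2(1)] 2 card_indep[OF assms(1-3)]
    unfolding classified_def by auto
qed

lemma level_splits:
  assumes "simple_adj adj" "finite V" "v \<in> V"
    and "classified adj (V - {v})" "classified adj (non_nbrs adj V v)" "classified adj V"
  shows "splits (level adj (V - {v})) (map_option Suc (level adj (non_nbrs adj V v))) (level adj V)"
  using assms(5)
proof (cases rule: classified_cases)
  case 1
  from assms(4) have "level adj V = level adj (V - {v})"
  proof (cases rule: classified_cases)
    case del: 1
    then show ?thesis using contractible_link_delete(1)[OF assms(1-3) 1(1)] by (simp add: level_None)
  next
    case del: (2 m)
    then have "level adj V = Some m"
      using contractible_link_delete(2)[OF assms(1-3) 1(1)] by (simp add: level_eq)
    then show ?thesis using del by simp
  qed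
  then show ?thesis using 1 by (simp add: splits_def)
next
  case N: (2 b)
  from assms(4) show ?thesis
  proof (cases rule: classified_cases)
    case 1
    then have "level adj V = Some (Suc b)"
      using contractible_deletion_suspend[OF assms(1-3) 1(1) N(1)] by (simp add: level_eq)
    then show ?thesis using 1 N by (simp add: splits_def)
  next
    case (2 a)
    then have "even (card (indep adj V))" using N card_indep[OF assms(1-3)] by simp
    then have c: "stably_contractible adj V" using assms(6) by (auto simp: classified_def)
    then have "a = b" using contractible_balance[OF assms(1-3) c 2(1) N(1)] by simp
    then show ?thesis using 2 N level_None[OF c] by (simp add: splits_def)
  qed
qed

lemma splits_add:
  "splits p (map_option Suc q) r \<Longrightarrow>
    splits (map_option ((+) c) p) (map_option ((+) (Suc c)) q) (map_option ((+) c) r)"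
  by (cases p; cases q; cases r) (auto simp: splits_def)

text \<open>
  In a minimal counterexample the link and the deletion of every vertex have an odd number of
  independent sets, for otherwise \<open>classified_step\<close> would apply.  This gives the levels of the
  patterns on a single vertex that the locale \<open>critical\<close> demands.
\<close>

theorem classification:
  assumes adj: "simple_adj adj" and "finite V"
    and "\<And>xs. distinct xs \<Longrightarrow> set xs \<subseteq> V \<Longrightarrow> 3 \<le> length xs \<Longrightarrow> successively adj xs \<Longrightarrow>
      adj (last xs) (hd xs) \<Longrightarrow> \<not> 3 dvd length xs"
  shows "classified adj V"
  using assms(2,3)
proof (induction "card V" arbitrary: V rule: less_induct)
  case less
  have smaller: "classified adj U" if "U \<subset> V" for U
  proof (rule less.hyps)
    show "card U < card V" "finite U" using less.prems(1) that by (auto intro: psubset_card_mono finite_subset)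
    fix xs assume "distinct xs" "set xs \<subseteq> U" "3 \<le> length xs" "successively adj xs" "adj (last xs) (hd xs)"
    then show "\<not> 3 dvd length xs" using less.prems(2)[of xs] that by auto
  qed
  have N: "non_nbrs adj V v \<subset> V" if "v \<in> V" for v using that by (auto simp: non_nbrs_def)
  show ?case
  proof (rule ccontr)
    assume not: "\<not> classified adj V"
    have "V \<noteq> {}"
    proof
      assume "V = {}"
      moreover have "indep adj {} = {{}}" by (auto simp: indep_def)
      ultimately show False using not stably_sphere_empty[of adj] by (auto simp: classified_def)
    qed
    have odd: "odd (card (indep adj (V - {v})))" "odd (card (indep adj (non_nbrs adj V v)))" if "v \<in> V" for v
      using classified_step[OF adj less.prems(1) that smaller smaller[OF N[OF that]]] not that by (simp_all add: psubset_eq, blast+)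
    have nbr: "\<exists>u\<in>V. adj v u" if v: "v \<in> V" for v
    proof (rule ccontr)
      assume "\<not> ?thesis"
      then have iso: "\<And>u. u \<in> V \<Longrightarrow> \<not> adj v u" by blast
      then have "non_nbrs adj V v = V - {v}" by (auto simp: non_nbrs_def)
      then have "even (card (indep adj V))" using card_indep[OF adj less.prems(1) v] by simp
      then show False
        using isolated_stably_contractible[OF adj less.prems(1) v iso] not by (auto simp: classified_def)
    qed
    \<comment> \<open>the graph that remains when \<open>X\<close> is forced out and \<open>Y\<close> is forced in\<close>
    define rest where "rest X Y = {u \<in> V. u \<notin> X \<and> u \<notin> Y \<and> (\<forall>y\<in>Y. \<not> adj y u)}" for X Y
    define lev where "lev X Y = (if \<forall>u\<in>Y. \<forall>v\<in>Y. \<not> adj u v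
      then map_option ((+) (card Y)) (level adj (rest X Y)) else None)" for X Y
    have critical: "critical V adj lev"
    proof
      show "finite V" "V \<noteq> {}" by fact+
      show "adj u v \<Longrightarrow> adj v u" "\<not> adj v v" for u v using adj by (auto simp: simple_adj_def)
      show "\<exists>u\<in>V. adj v u" if "v \<in> V" for v using nbr[OF that] .
      show "lev X Y = None" if "u \<in> Y" "v \<in> Y" "adj u v" for u v X Y using that by (auto simp: lev_def)
      fix v assume v: "v \<in> V"
      have "rest {v} {} = V - {v}" "rest {} {v} = non_nbrs adj V v"
        by (auto simp: rest_def non_nbrs_def)
      moreover have "level adj (V - {v}) \<noteq> None"
        using level_odd[OF smaller, of "V - {v}"] odd(1)[OF v] v by auto
      moreover have "level adj (non_nbrs adj V v) \<noteq> None"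
        using level_odd[OF smaller[OF N[OF v]]] odd(2)[OF v] by simp
      ultimately show "lev {v} {} \<noteq> None" "lev {} {v} \<noteq> None"
        using adj by (auto simp: lev_def simple_adj_def)
    next
      fix X Y v assume XY: "X \<subseteq> V" "Y \<subseteq> V" "X \<inter> Y = {}" "X \<union> Y \<noteq> {}"
        and v: "v \<in> V" "v \<notin> X" "v \<notin> Y" "\<And>u. u \<in> V \<Longrightarrow> adj v u \<Longrightarrow> u \<in> X"
      have "v \<in> rest X Y" using XY v adj unfolding rest_def simple_adj_def by blast
      moreover have "\<not> adj v u" if "u \<in> rest X Y" for u using that v by (auto simp: rest_def)
      moreover have "finite (rest X Y)" using less.prems(1) by (simp add: rest_def)
      ultimately have "level adj (rest X Y) = None"
        using level_None isolated_stably_contractible[OF adj] by blast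
      then show "lev X Y = None" by (simp add: lev_def)
    next
      fix X Y w assume XY: "X \<subseteq> V" "Y \<subseteq> V" "X \<inter> Y = {}" "X \<union> Y \<noteq> {}" and w: "w \<in> V" "w \<notin> X" "w \<notin> Y"
      show "splits (lev (insert w X) Y) (lev X (insert w Y)) (lev X Y)"
      proof (cases "\<forall>u\<in>Y. \<forall>v\<in>Y. \<not> adj u v")
        case False
        then show ?thesis by (auto simp: lev_def splits_def)
      next
        case ind: True
        show ?thesis
        proof (cases "\<exists>y\<in>Y. adj y w")
          case True
          then have "rest (insert w X) Y = rest X Y" by (auto simp: rest_def)
          moreover have "lev X (insert w Y) = None" using True by (auto simp: lev_def)
          ultimately show ?thesis by (simp add: lev_def splits_def)
        next
          case False
          let ?K = "rest X Y"
          have K: "w \<in> ?K" "finite ?K" using False w less.prems(1) by (auto simp: rest_def)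
          have "?K \<subset> V" using XY by (auto simp: rest_def)
          moreover have "?K - {w} \<subset> V" "non_nbrs adj ?K w \<subset> V"
            using w by (auto simp: rest_def non_nbrs_def)
          ultimately have "splits (level adj (?K - {w})) (map_option Suc (level adj (non_nbrs adj ?K w))) (level adj ?K)"
            using level_splits[OF adj K(2,1)] smaller by blast
          moreover have "rest (insert w X) Y = ?K - {w}" "rest X (insert w Y) = non_nbrs adj ?K w"
            by (auto simp: rest_def non_nbrs_def)
          moreover have "\<forall>u\<in>insert w Y. \<forall>v\<in>insert w Y. \<not> adj u v"
            using ind False adj by (auto simp: simple_adj_def)
          moreover have "card (insert w Y) = Suc (card Y)"
            using w XY(2) less.prems(1) by (simp add: finite_subset)
          ultimately show ?thesis
            using splits_add[of _ _ _ "card Y"] ind by (simp add: lev_def)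
        qed
      qed
    qed
    obtain xs where "distinct xs" "set xs \<subseteq> V" "3 \<le> length xs"
      "3 dvd length xs" "successively adj xs" "adj (last xs) (hd xs)"
      by (rule critical.cycle_mod_3[OF critical])
    then show False using less.prems(2) by blast
  qed
qed


lemma (in wf_digraph) awalk_of_vertices:
  assumes "xs \<noteq> []" "set xs \<subseteq> verts G" "successively (dominates G) xs"
  shows "\<exists>p. awalk (hd xs) p (last xs) \<and> awalk_verts (hd xs) p = xs"
  using assms
proof (induction xs rule: induct_list012)
  case (2 x)
  then show ?case by (intro exI[of _ "[]"]) (simp add: awalk_Nil_iff)
next
  case (3 x y zs)
  then obtain p where p: "awalk y p (last (y # zs))" "awalk_verts y p = y # zs" by auto
  obtain e where e: "e \<in> arcs G" "tail G e = x" "head G e = y"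
    using 3(5) by (auto simp: arcs_ends_conv)
  then show ?case using p by (intro exI[of _ "e # p"]) (simp add: awalk_Cons_iff)
qed simp

lemma ucycle_of_vertices:
  assumes "graph G" "distinct xs" "set xs \<subseteq> verts G" "3 \<le> length xs"
    "successively (dominates G) xs" "last xs \<rightarrow>\<^bsub>G\<^esub> hd xs"
  shows "\<exists>p. ucycle G p \<and> length p = length xs"
proof -
  interpret graph G by fact
  have ne: "xs \<noteq> []" using assms(4) by auto
  have hd: "hd xs \<in> verts G" using hd_in_set[OF ne] assms(3) by blast
  have "successively (dominates G) (xs @ [hd xs])"
    using assms ne by (simp add: successively_append_iff)
  then obtain p where p: "awalk (hd xs) p (hd xs)" "awalk_verts (hd xs) p = xs @ [hd xs]"
    using awalk_of_vertices[of "xs @ [hd xs]"] assms(3) ne hd by auto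
  have len: "length p = length xs" using length_awalk_verts[of "hd xs" p] p(2) by simp
  have "distinct (tl xs @ [hd xs])" using assms(2) ne by (cases xs) auto
  then have "cycle p" using p ne len assms(4) unfolding cycle_def by auto
  then show ?thesis using len assms(4) by (auto simp: ucycle_def)
qed

theorem theorem1p4:
  fixes G :: "('a, 'b) pre_digraph"
  assumes "graph G"
    and "\<not> (\<exists>p. ucycle G p \<and> 3 dvd length p)"
  defines "X \<equiv> geometric_realization (independence_complex G)"
  shows "(topspace X \<noteq> {} \<and> contractible_space X) \<or>
    (\<exists>d::int. d \<ge> -1 \<and> X homotopy_equivalent_space sphere_space d)"
proof -
  interpret graph G by fact
  let ?adj = "dominates G"
  have adj: "simple_adj ?adj"
    unfolding simple_adj_def using sym_arcs no_loops
    by (auto simp: symmetric_def arcs_ends_conv dest: symD)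
  have "classified ?adj (verts G)"
  proof (rule classification[OF adj])
    fix xs assume xs: "distinct xs" "set xs \<subseteq> verts G" "3 \<le> length xs" "successively ?adj xs" "?adj (last xs) (hd xs)"
    then obtain p where "ucycle G p" "length p = length xs" using ucycle_of_vertices[OF assms(1)] by blast
    then show "\<not> 3 dvd length xs" using assms(2) by metis
  qed simp
  moreover have X: "X homotopy_equivalent_space susp_space ?adj (verts G) 0"
  proof -
    have "X = ind_space ?adj (verts G)"
      by (simp add: X_def ind_space_def independence_complex_def independent_set_def indep_def)
    moreover have "ind_space ?adj (verts G) homotopy_equivalent_space ind_space (sum_adj ?adj) (Inl ` verts G)"
      by (rule ind_space_relabel) (auto simp: inj_on_def)
    ultimately show ?thesis by (simp add: susp_space_def with_edges_def)
  qed
  ultimately consider "pointlike (susp_space ?adj (verts G) 0)"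
    | m where "susp_space ?adj (verts G) 0 homotopy_equivalent_space sphere_space (int m - 1)"
    unfolding classified_def stably_contractible_def stably_sphere_def by (metis add_0_right)
  then show ?thesis
  proof cases
    case 1
    then show ?thesis using pointlike_homotopy_equivalent[OF X] by (simp add: pointlike_def)
  next
    case (2 m)
    then have "X homotopy_equivalent_space sphere_space (int m - 1)" using homotopy_eqv_trans[OF X] by blast
    then show ?thesis by (intro disjI2 exI[of _ "int m - 1"]) auto
  qed
qed

end
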